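(* Let $G$ be an lcsc group, $U\subset G$ a closed subgroup and $V\triangleleft G$ a closed normal amenable subgroup such that $\psi:U\times V\to G$, $\psi(u,v)=uv$, is a homeomorphism. Let $E_T\subset U$, $F_S\subset V$ be compact sets of positive finite Haar measure (for left Haar measures $m_U$, $m_V$) such that $F_S$ is Følner ($m_V(F_Sv\,\Delta F_S)/m_V(F_S)\to0$ for every $v\in V$) and both families of normalized averages satisfy the strong maximal inequality and the pointwise ergodic theorem in $L^p$, $1<p<\infty$, in every probability-preserving action of $U$ (resp. $V$). Suppose $G$ acts ergodically by measure-preserving transformations on a probability space $(X,m)$, with $\pi(g)f(x)=f(g^{-1}x)$. Then for every $f\in L^p(X)$, $1<p<\infty$, and almost every $x$, $$\lim_{\min(T,S)\to\infty}\frac{1}{m_U(E_T)m_V(F_S)}\int_{E_T}\int_{F_S}\pi(uv)f(x)\,dm_V(v)\,dm_U(u)=\int_X f\,dm,$$ with convergence also in $L^p$-norm. Moreover, the averages on the left coincide with $\frac{1}{m_G(Q_{T,S})}\int_{Q_{T,S}}\pi(g)f(x)\,dm_G(g)$, where $Q_{T,S}=\psi(E_T\times F_S)$ and $m_G=\psi_*(m_U\times m_V)$ is a left Haar measure on $G$. *)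

theory Defs
  imports "HOL-Analysis.Analysis" "HOL-Probability.Probability" "HOL-Algebra.Coset"
begin

definition borel_of :: "'a topology \<Rightarrow> 'a measure" where
  "borel_of \<tau> = sigma (topspace \<tau>) {U. openin \<tau> U}"

definition lcsc_group :: "('g, 'b) monoid_scheme \<Rightarrow> 'g topology \<Rightarrow> bool" where
  "lcsc_group G \<tau> \<longleftrightarrow> group G \<and> topspace \<tau> = carrier G \<and>
     Hausdorff_space \<tau> \<and> locally_compact_space \<tau> \<and> second_countable \<tau> \<and>
     continuous_map (prod_topology \<tau> \<tau>) \<tau> (\<lambda>(x, y). x \<otimes>\<^bsub>G\<^esub> y) \<and>
     continuous_map \<tau> \<tau> (\<lambda>x. inv\<^bsub>G\<^esub> x)"

text \<open>Left Haar measure on a closed subgroup H of G (with the subspace topology):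
  a Borel measure on H which is finite on compact sets, positive on nonempty open sets
  and invariant under left translations by elements of H.  (On lcsc groups such measures
  are automatically Radon.)\<close>
definition left_haar :: "('g, 'b) monoid_scheme \<Rightarrow> 'g topology \<Rightarrow> 'g set \<Rightarrow> 'g measure \<Rightarrow> bool" where
  "left_haar G \<tau> H \<mu> \<longleftrightarrow>
     sets \<mu> = sets (borel_of (subtopology \<tau> H)) \<and> space \<mu> = H \<and>
     (\<forall>K. compactin (subtopology \<tau> H) K \<longrightarrow> emeasure \<mu> K < \<infinity>) \<and>
     (\<forall>W. openin (subtopology \<tau> H) W \<and> W \<noteq> {} \<longrightarrow> emeasure \<mu> W > 0) \<and>
     (\<forall>h\<in>H. \<forall>A\<in>sets \<mu>. emeasure \<mu> ((\<lambda>x. h \<otimes>\<^bsub>G\<^esub> x) ` A) = emeasure \<mu> A)"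

text \<open>Amenability of a (closed) subgroup H, via existence of a left-invariant mean on
  the bounded Borel functions modulo null sets (i.e. on L-infinity of the Haar measure).\<close>
definition amenable :: "('g, 'b) monoid_scheme \<Rightarrow> 'g topology \<Rightarrow> 'g set \<Rightarrow> bool" where
  "amenable G \<tau> H \<longleftrightarrow> (\<exists>\<mu> (M :: ('g \<Rightarrow> real) \<Rightarrow> real). left_haar G \<tau> H \<mu> \<and>
     (\<forall>f c. f \<in> borel_measurable \<mu> \<and> (\<forall>x\<in>H. \<bar>f x\<bar> \<le> c) \<longrightarrow>
        (\<forall>g. g \<in> borel_measurable \<mu> \<and> (\<exists>d. \<forall>x\<in>H. \<bar>g x\<bar> \<le> d) \<longrightarrow>
             M (\<lambda>x. f x + g x) = M f + M g) \<and>
        (\<forall>a. M (\<lambda>x. a * f x) = a * M f) \<and>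
        ((AE x in \<mu>. f x \<ge> 0) \<longrightarrow> M f \<ge> 0) \<and>
        (\<forall>h\<in>H. M (\<lambda>x. f (h \<otimes>\<^bsub>G\<^esub> x)) = M f)) \<and>
     M (\<lambda>x. 1) = 1)"

definition mp_action :: "('g, 'b) monoid_scheme \<Rightarrow> 'g topology \<Rightarrow> 'g set \<Rightarrow> 'x measure \<Rightarrow> ('g \<Rightarrow> 'x \<Rightarrow> 'x) \<Rightarrow> bool" where
  "mp_action G \<tau> H Y a \<longleftrightarrow> prob_space Y \<and>
     (\<forall>y\<in>space Y. a \<one>\<^bsub>G\<^esub> y = y) \<and>
     (\<forall>g\<in>H. \<forall>h\<in>H. \<forall>y\<in>space Y. a (g \<otimes>\<^bsub>G\<^esub> h) y = a g (a h y)) \<and>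
     (\<forall>g\<in>H. a g \<in> measurable Y Y \<and> distr Y Y (a g) = Y) \<and>
     (\<lambda>(g, y). a g y) \<in> measurable (borel_of (subtopology \<tau> H) \<Otimes>\<^sub>M Y) Y"

definition ergodic_action :: "('g, 'b) monoid_scheme \<Rightarrow> 'g set \<Rightarrow> 'x measure \<Rightarrow> ('g \<Rightarrow> 'x \<Rightarrow> 'x) \<Rightarrow> bool" where
  "ergodic_action G H Y a \<longleftrightarrow>
     (\<forall>A\<in>sets Y. (\<forall>g\<in>H. a g -` A \<inter> space Y = A) \<longrightarrow> measure Y A = 0 \<or> measure Y A = 1)"

definition invariant_sigma :: "'g set \<Rightarrow> 'x measure \<Rightarrow> ('g \<Rightarrow> 'x \<Rightarrow> 'x) \<Rightarrow> 'x measure" where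
  "invariant_sigma H Y a = sigma (space Y) {A \<in> sets Y. \<forall>g\<in>H. a g -` A \<inter> space Y = A}"

definition Lp_fun :: "real \<Rightarrow> 'x measure \<Rightarrow> ('x \<Rightarrow> real) \<Rightarrow> bool" where
  "Lp_fun p Y f \<longleftrightarrow> f \<in> borel_measurable Y \<and> integrable Y (\<lambda>x. \<bar>f x\<bar> powr p)"

definition rep :: "('g, 'b) monoid_scheme \<Rightarrow> ('g \<Rightarrow> 'x \<Rightarrow> 'x) \<Rightarrow> 'g \<Rightarrow> ('x \<Rightarrow> real) \<Rightarrow> 'x \<Rightarrow> real" where
  "rep G a g f x = f (a (inv\<^bsub>G\<^esub> g) x)"

definition avg :: "('g, 'b) monoid_scheme \<Rightarrow> 'g measure \<Rightarrow> 'g set \<Rightarrow> ('g \<Rightarrow> 'x \<Rightarrow> 'x) \<Rightarrow> ('x \<Rightarrow> real) \<Rightarrow> 'x \<Rightarrow> real" where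
  "avg G \<mu> E a f x = (LINT h:E|\<mu>. rep G a h f x) / measure \<mu> E"

definition strong_maximal_ineq :: "('g, 'b) monoid_scheme \<Rightarrow> 'g measure \<Rightarrow> (real \<Rightarrow> 'g set) \<Rightarrow> real \<Rightarrow> 'x measure \<Rightarrow> ('g \<Rightarrow> 'x \<Rightarrow> 'x) \<Rightarrow> bool" where
  "strong_maximal_ineq G \<mu> E p Y a \<longleftrightarrow> (\<exists>C::real. \<forall>f. Lp_fun p Y f \<longrightarrow>
     (\<integral>\<^sup>+ y. (SUP T\<in>{0<..}. ennreal (\<bar>avg G \<mu> (E T) a f y\<bar> powr p)) \<partial>Y)
        \<le> ennreal C * (\<integral>\<^sup>+ y. ennreal (\<bar>f y\<bar> powr p) \<partial>Y))"

definition pointwise_ergodic_thm :: "('g, 'b) monoid_scheme \<Rightarrow> 'g set \<Rightarrow> 'g measure \<Rightarrow> (real \<Rightarrow> 'g set) \<Rightarrow> real \<Rightarrow> 'x measure \<Rightarrow> ('g \<Rightarrow> 'x \<Rightarrow> 'x) \<Rightarrow> bool" where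
  "pointwise_ergodic_thm G H \<mu> E p Y a \<longleftrightarrow> (\<forall>f. Lp_fun p Y f \<longrightarrow>
     (AE y in Y. ((\<lambda>T. avg G \<mu> (E T) a f y) \<longlongrightarrow> real_cond_exp Y (invariant_sigma H Y a) f y) at_top) \<and>
     ((\<lambda>T. \<integral>\<^sup>+ y. ennreal (\<bar>avg G \<mu> (E T) a f y - real_cond_exp Y (invariant_sigma H Y a) f y\<bar> powr p) \<partial>Y)
        \<longlongrightarrow> 0) at_top)"

end

theory Submission
  imports Defs
begin

text \<open>Since \<open>\<pi>(uv)f(x)\<close> is the value of \<open>\<pi>(v)f\<close> at \<open>u\<^sup>-\<^sup>1x\<close>, the double average is the \<open>U\<close>-average
  of the \<open>V\<close>-average \<open>A\<^sub>S f\<close>. Let \<open>h\<close> be the conditional expectation of \<open>f\<close> on the \<open>V\<close>-invariant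
  sets. As \<open>V\<close> is normal, the \<open>U\<close>-averages of \<open>h\<close> are again \<open>V\<close>-invariant, so their limit is both
  \<open>U\<close>- and \<open>V\<close>-invariant, hence constant by ergodicity. The remainder \<open>A\<^sub>S f - h\<close> is dominated, for
  all large \<open>S\<close> at once, by a function of small integral: the maximal inequality for \<open>V\<close> reduces this to
  bounded \<open>f\<close>, where it is dominated convergence. The pointwise theorem for \<open>U\<close>, applied to the
  dominating function, then controls the \<open>U\<close>-averages of the remainder uniformly in \<open>S\<close>.\<close>

section \<open>Borel measures on locally compact second countable spaces\<close>

text \<open>Pointwise convergence of the \<open>V\<close>-averages cannot be used directly: it would
  be needed at the points \<open>a (inv u) x\<close> for all u in \<open>E T\<close>, a set that
  changes with T, while S grows independently. A majorant that does not depend on S removes this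
  difficulty, but its \<open>U\<close>-averages tend to a conditional expectation that is small only
  in mean. A sequence of majorants whose integrals tend to 0, and the infimum of these limits, make
  it small at almost every x. Null sets shape the rest. The parameters are real and nothing relates
  \<open>E T\<close> to nearby parameters, so suprema over T become measurable only through
  separability of the compact sets under symmetric differences. Moreover \<open>G\<close> may be
  uncountable, so ergodicity must be applied to a strictly invariant set, while the limit of the
  averages of \<open>h\<close> has one version that is strictly invariant under \<open>U\<close> and
  another that is strictly invariant under \<open>V\<close>, and the two agree only almost
  everywhere. Norm convergence is easier: the maximal inequality bounds the
  \<open>U\<close>-averages on L^p uniformly in T.\<close>

lemma space_borel_of [simp]: "space (borel_of \<tau>) = topspace \<tau>"
  unfolding borel_of_def by (rule space_measure_of) (auto dest: openin_subset)

lemma sets_borel_of: "sets (borel_of \<tau>) = sigma_sets (topspace \<tau>) {U. openin \<tau> U}"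
  unfolding borel_of_def by (rule sets_measure_of) (auto dest: openin_subset)

lemma borel_of_open: "openin \<tau> A \<Longrightarrow> A \<in> sets (borel_of \<tau>)"
  by (auto simp: sets_borel_of)

lemma borel_of_closed:
  assumes "closedin \<tau> A" shows "A \<in> sets (borel_of \<tau>)"
proof -
  have "topspace \<tau> - (topspace \<tau> - A) \<in> sets (borel_of \<tau>)"
    using assms borel_of_open[of \<tau> "topspace \<tau> - A"] sets.compl_sets[of "topspace \<tau> - A" "borel_of \<tau>"]
    by (simp add: closedin_def)
  moreover have "topspace \<tau> - (topspace \<tau> - A) = A"
    using assms closedin_subset by blast
  ultimately show ?thesis by simp
qed

lemma measurable_borel_of:
  assumes "\<And>x. x \<in> space M \<Longrightarrow> f x \<in> topspace \<tau>"
    and "\<And>W. openin \<tau> W \<Longrightarrow> f -` W \<inter> space M \<in> sets M"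
  shows "f \<in> measurable M (borel_of \<tau>)"
  unfolding borel_of_def
  by (rule measurable_measure_of) (use assms in \<open>auto dest: openin_subset\<close>)

lemma continuous_map_measurable_borel_of:
  assumes "continuous_map \<sigma> \<tau> f"
  shows "f \<in> measurable (borel_of \<sigma>) (borel_of \<tau>)"
proof (rule measurable_borel_of)
  fix W assume "openin \<tau> W"
  then have "openin \<sigma> {x \<in> topspace \<sigma>. f x \<in> W}"
    using assms by (rule openin_continuous_map_preimage[rotated])
  moreover have "f -` W \<inter> space (borel_of \<sigma>) = {x \<in> topspace \<sigma>. f x \<in> W}" by auto
  ultimately show "f -` W \<inter> space (borel_of \<sigma>) \<in> sets (borel_of \<sigma>)"
    by (simp add: borel_of_open)
qed (use assms in \<open>auto simp: continuous_map_def\<close>)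

text \<open>Second countability turns an open set into a countable union of open rectangles; for
  general spaces the product sigma-algebra can miss open sets of the product.\<close>

lemma open_prod_topology_measurable:
  assumes "second_countable \<sigma>" "second_countable \<tau>" and W: "openin (prod_topology \<sigma> \<tau>) W"
  shows "W \<in> sets (borel_of \<sigma> \<Otimes>\<^sub>M borel_of \<tau>)"
proof -
  obtain B where B: "countable B" "\<And>V. V \<in> B \<Longrightarrow> openin \<sigma> V"
    "\<And>U x. openin \<sigma> U \<Longrightarrow> x \<in> U \<Longrightarrow> \<exists>V\<in>B. x \<in> V \<and> V \<subseteq> U"
    using assms(1) unfolding second_countable_def by metis
  obtain C where C: "countable C" "\<And>V. V \<in> C \<Longrightarrow> openin \<tau> V"
    "\<And>U x. openin \<tau> U \<Longrightarrow> x \<in> U \<Longrightarrow> \<exists>V\<in>C. x \<in> V \<and> V \<subseteq> U"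
    using assms(2) unfolding second_countable_def by metis
  have "W = (\<Union>(b, c)\<in>{(b, c) \<in> B \<times> C. b \<times> c \<subseteq> W}. b \<times> c)" (is "_ = ?R")
  proof
    show "W \<subseteq> ?R"
    proof
      fix z assume z: "z \<in> W"
      obtain x y where xy: "z = (x, y)" by (cases z)
      obtain P Q where PQ: "openin \<sigma> P" "openin \<tau> Q" "x \<in> P" "y \<in> Q" "P \<times> Q \<subseteq> W"
        using W[unfolded openin_prod_topology_alt, rule_format, of x y] z xy by auto
      then obtain b c where "b \<in> B" "x \<in> b" "b \<subseteq> P" "c \<in> C" "y \<in> c" "c \<subseteq> Q"
        using B(3) C(3) by meson
      then have "(b, c) \<in> {(b, c) \<in> B \<times> C. b \<times> c \<subseteq> W}" "z \<in> b \<times> c"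
        using PQ(5) xy by auto
      then show "z \<in> ?R" by (intro UN_I[of "(b, c)"]) auto
    qed
  qed auto
  also have "\<dots> \<in> sets (borel_of \<sigma> \<Otimes>\<^sub>M borel_of \<tau>)"
  proof (rule sets.countable_UN')
    show "countable {(b, c) \<in> B \<times> C. b \<times> c \<subseteq> W}"
      by (rule countable_subset[of _ "B \<times> C"]) (use B(1) C(1) in auto)
  qed (use B(2) C(2) in \<open>auto intro!: pair_measureI borel_of_open\<close>)
  finally show ?thesis .
qed

lemma continuous_map_prod_measurable_borel_of:
  assumes "second_countable \<sigma>" "second_countable \<tau>" "continuous_map (prod_topology \<sigma> \<tau>) \<rho> f"
  shows "f \<in> measurable (borel_of \<sigma> \<Otimes>\<^sub>M borel_of \<tau>) (borel_of \<rho>)"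
proof (rule measurable_borel_of)
  fix W assume "openin \<rho> W"
  then have "openin (prod_topology \<sigma> \<tau>) {x \<in> topspace (prod_topology \<sigma> \<tau>). f x \<in> W}"
    using assms(3) by (rule openin_continuous_map_preimage[rotated])
  moreover have "f -` W \<inter> space (borel_of \<sigma> \<Otimes>\<^sub>M borel_of \<tau>) = {x \<in> topspace (prod_topology \<sigma> \<tau>). f x \<in> W}"
    by (auto simp: space_pair_measure)
  ultimately show "f -` W \<inter> space (borel_of \<sigma> \<Otimes>\<^sub>M borel_of \<tau>) \<in> sets (borel_of \<sigma> \<Otimes>\<^sub>M borel_of \<tau>)"
    using assms by (simp add: open_prod_topology_measurable)
qed (use assms in \<open>auto simp: continuous_map_def space_pair_measure Pi_iff\<close>)

section \<open>Locally finite Borel measures: exhaustion and separability\<close>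

locale lcsc_borel_measure =
  fixes \<tau> :: "'a topology" and \<mu> :: "'a measure"
  assumes hausdorff: "Hausdorff_space \<tau>"
    and loc_compact: "locally_compact_space \<tau>"
    and second_countable: "second_countable \<tau>"
    and sets_eq [measurable_cong]: "sets \<mu> = sets (borel_of \<tau>)"
    and compact_finite: "\<And>K. compactin \<tau> K \<Longrightarrow> emeasure \<mu> K < \<infinity>"
begin

lemma space_eq: "space \<mu> = topspace \<tau>"
  using sets_eq_imp_space_eq[OF sets_eq] by simp

lemma open_sets: "openin \<tau> W \<Longrightarrow> W \<in> sets \<mu>"
  by (simp add: sets_eq borel_of_open)

lemma compact_sets: "compactin \<tau> K \<Longrightarrow> K \<in> sets \<mu>"
  by (simp add: sets_eq borel_of_closed compactin_imp_closedin hausdorff)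

lemma compact_fmeasurable: "compactin \<tau> K \<Longrightarrow> K \<in> fmeasurable \<mu>"
  using compact_finite[of K] compact_sets[of K] by (auto simp: fmeasurable_def)

text \<open>Local compactness gives each point an open neighbourhood of finite measure, and the
  Lindelof property leaves countably many. The members are kept open so that a finite subcover puts
  every compact set inside one of them.\<close>

lemma open_exhaustion:
  obtains W :: "nat \<Rightarrow> 'a set" where "\<And>n. openin \<tau> (W n)" "\<And>n. emeasure \<mu> (W n) < \<infinity>" "incseq W"
    "(\<Union>n. W n) = topspace \<tau>" "\<And>K. compactin \<tau> K \<Longrightarrow> \<exists>n. K \<subseteq> W n"
proof -
  define \<O> where "\<O> = {W. openin \<tau> W \<and> emeasure \<mu> W < \<infinity>}"
  have "\<exists>W\<in>\<O>. x \<in> W" if x: "x \<in> topspace \<tau>" for x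
  proof -
    obtain U K where UK: "openin \<tau> U" "compactin \<tau> K" "x \<in> U" "U \<subseteq> K"
      using loc_compact x unfolding locally_compact_space_def by blast
    then have "emeasure \<mu> U \<le> emeasure \<mu> K" by (intro emeasure_mono compact_sets)
    then have "emeasure \<mu> U < \<infinity>" using compact_finite[OF UK(2)] by (rule le_less_trans)
    with UK show ?thesis by (auto simp: \<O>_def)
  qed
  then have "\<Union>\<O> = topspace \<tau>" by (auto simp: \<O>_def dest: openin_subset)
  then obtain \<V> where V: "countable \<V>" "\<V> \<subseteq> \<O>" "\<Union>\<V> = topspace \<tau>"
    using second_countable_imp_Lindelof_space[OF second_countable]
    unfolding Lindelof_space_def \<O>_def by (metis (mono_tags, lifting) mem_Collect_eq)
  \<comment> \<open>The empty set keeps the enumerated family nonempty, as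
    \<open>from_nat_into\<close> requires, even over an empty space.\<close>
  define c where "c = from_nat_into (insert {} \<V>)"
  have c: "range c = insert {} \<V>"
    unfolding c_def by (rule range_from_nat_into) (use V in auto)
  have cO: "openin \<tau> (c i)" "emeasure \<mu> (c i) < \<infinity>" for i
  proof -
    have "c i \<in> insert {} \<V>" using c by blast
    then show "openin \<tau> (c i)" "emeasure \<mu> (c i) < \<infinity>"
      using V(2) by (auto simp: \<O>_def)
  qed
  define W where "W n = (\<Union>i\<le>n. c i)" for n
  have inc: "incseq W" unfolding W_def by (auto simp: incseq_def intro: order_trans)
  have un: "(\<Union>n. W n) = topspace \<tau>"
  proof -
    have "(\<Union>n. W n) = \<Union>(range c)" unfolding W_def by auto
    then show ?thesis using c V(3) by simp
  qed
  have op: "openin \<tau> (W n)" for n unfolding W_def using cO by auto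
  show thesis
  proof (rule that[of W, OF op _ inc un])
    fix n
    have "emeasure \<mu> (W n) \<le> (\<Sum>i\<le>n. emeasure \<mu> (c i))"
      unfolding W_def by (rule emeasure_subadditive_finite) (use cO open_sets in auto)
    also have "\<dots> < \<infinity>" using cO(2) by simp
    finally show "emeasure \<mu> (W n) < \<infinity>" .
  next
    fix K assume K: "compactin \<tau> K"
    then have "K \<subseteq> \<Union>(range W)" using un compactin_subset_topspace by fastforce
    then obtain \<F> where F: "finite \<F>" "\<F> \<subseteq> range W" "K \<subseteq> \<Union>\<F>"
      using K op unfolding compactin_def by (metis (no_types, lifting) rangeE)
    then obtain J where J: "finite J" "\<F> = W ` J" by (metis finite_subset_image)
    have "W j \<subseteq> W (Max (insert 0 J))" if "j \<in> J" for j
      using inc J that by (auto simp: incseq_def)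
    then have "\<Union>\<F> \<subseteq> W (Max (insert 0 J))" using J(2) by auto
    with F(3) show "\<exists>n. K \<subseteq> W n" by (intro exI[of _ "Max (insert 0 J)"]) (rule order_trans)
  qed
qed

lemma sigma_finite: "sigma_finite_measure \<mu>"
proof -
  obtain W :: "nat \<Rightarrow> 'a set" where W: "\<And>n. openin \<tau> (W n)" "\<And>n. emeasure \<mu> (W n) < \<infinity>"
    "(\<Union>n. W n) = topspace \<tau>" by (rule open_exhaustion) metis
  show ?thesis
    by standard (rule exI[of _ "range W"], use W open_sets space_eq in \<open>auto simp: less_top\<close>)
qed

text \<open>The countable family consists of the finite intersections of finite unions of members of a
  countable base, cut down to open sets of finite measure.\<close>
lemma compact_outer_approx:
  obtains \<D> where "countable \<D>" "\<D> \<subseteq> sets \<mu>"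
    "\<And>K e. compactin \<tau> K \<Longrightarrow> e > 0 \<Longrightarrow> \<exists>W\<in>\<D>. K \<subseteq> W \<and> W \<in> fmeasurable \<mu> \<and> measure \<mu> W < measure \<mu> K + e"
proof -
  obtain B where B: "countable B" "\<And>V. V \<in> B \<Longrightarrow> openin \<tau> V"
    "\<And>U x. openin \<tau> U \<Longrightarrow> x \<in> U \<Longrightarrow> \<exists>V\<in>B. x \<in> V \<and> V \<subseteq> U"
    using second_countable unfolding second_countable_def by metis
  obtain O' :: "nat \<Rightarrow> 'a set" where O': "\<And>n. openin \<tau> (O' n)" "\<And>n. emeasure \<mu> (O' n) < \<infinity>"
    "\<And>K. compactin \<tau> K \<Longrightarrow> \<exists>n. K \<subseteq> O' n" by (rule open_exhaustion) metis
  define \<U> where "\<U> = Union ` {F. finite F \<and> F \<subseteq> B}"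
  define \<D> where "\<D> = (\<lambda>(\<F>, n). O' n \<inter> \<Inter>\<F>) ` ({\<F>. finite \<F> \<and> \<F> \<subseteq> \<U>} \<times> UNIV)"
  have cU: "countable \<U>" unfolding \<U>_def using B(1) by (intro countable_image countable_Collect_finite_subset)
  have oU: "openin \<tau> W" if "W \<in> \<U>" for W using that B(2) unfolding \<U>_def by auto
  have cD: "countable \<D>" unfolding \<D>_def
    using cU by (intro countable_image countable_SIGMA countable_Collect_finite_subset) auto
  have oI: "openin \<tau> (O' n \<inter> \<Inter>\<F>)" if "finite \<F>" "\<F> \<subseteq> \<U>" for \<F> n
    using that
  proof (induction \<F>)
    case empty then show ?case using O'(1) by simp
  next
    case (insert x F)
    have "O' n \<inter> \<Inter>(insert x F) = x \<inter> (O' n \<inter> \<Inter>F)" by auto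
    then show ?case using insert oU by (simp add: openin_Int)
  qed
  have sD: "\<D> \<subseteq> sets \<mu>" unfolding \<D>_def using oI open_sets by auto
  show thesis
  proof (rule that[OF cD sD])
    fix K and e :: real assume K: "compactin \<tau> K" and e: "e > 0"
    obtain n where n: "K \<subseteq> O' n" using O'(3)[OF K] by blast
    \<comment> \<open>The whole space makes the family nonempty before it is enumerated; it is
      removed again where \<open>Z m\<close> is recognised as a member of
      \<open>\<D>\<close>.\<close>
    define \<K> where "\<K> = insert (topspace \<tau>) {W\<in>\<U>. K \<subseteq> W}"
    have cK: "countable \<K>" "\<K> \<noteq> {}" unfolding \<K>_def using cU by auto
    define c where "c = from_nat_into \<K>"
    have c: "range c = \<K>" unfolding c_def using cK by (intro range_from_nat_into)
    define Z where "Z m = O' n \<inter> (\<Inter>i\<le>m. c i)" for m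
    have Zop: "openin \<tau> (Z m)" and KZ: "K \<subseteq> Z m" for m
    proof -
      have "openin \<tau> (c i)" for i
        using c oU unfolding \<K>_def by (metis (no_types, lifting) insertE mem_Collect_eq openin_topspace rangeI)
      then have "openin \<tau> (\<Inter>i\<le>m. c i)" by auto
      then show "openin \<tau> (Z m)" unfolding Z_def using O'(1) by auto
      have "K \<subseteq> c i" for i
        using c K compactin_subset_topspace unfolding \<K>_def by (metis (no_types, lifting) insertE mem_Collect_eq rangeI)
      then show "K \<subseteq> Z m" unfolding Z_def using n by auto
    qed
    have ZfM: "Z m \<in> fmeasurable \<mu>" for m
    proof (rule fmeasurableI2[of "O' n"])
      show "O' n \<in> fmeasurable \<mu>" using O' open_sets by (auto simp: fmeasurable_def)
    qed (use Zop open_sets in \<open>auto simp: Z_def\<close>)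
    \<comment> \<open>The Hausdorff property enters here: the basic open sets that miss a point x
      outside K cover K, and a finite union of them that still covers K is one of the sets
      \<open>c i\<close>, so x is excluded.\<close>
    have Zint: "(\<Inter>m. Z m) = K"
    proof
      show "K \<subseteq> (\<Inter>m. Z m)" using KZ by auto
      show "(\<Inter>m. Z m) \<subseteq> K"
      proof
        fix x assume x: "x \<in> (\<Inter>m. Z m)"
        show "x \<in> K"
        proof (rule ccontr)
          assume xK: "x \<notin> K"
          have xt: "x \<in> topspace \<tau>" using x Zop openin_subset by blast
          have op: "openin \<tau> (topspace \<tau> - {x})"
            using hausdorff by (simp add: open_in_Hausdorff_delete)
          define \<C> where "\<C> = {b\<in>B. x \<notin> b}"
          have "K \<subseteq> \<Union>\<C>"
          proof
            fix y assume y: "y \<in> K"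
            then have "y \<in> topspace \<tau> - {x}" using xK K compactin_subset_topspace by fastforce
            then obtain b where "b \<in> B" "y \<in> b" "b \<subseteq> topspace \<tau> - {x}" using B(3)[OF op] by blast
            then show "y \<in> \<Union>\<C>" unfolding \<C>_def by auto
          qed
          moreover have "\<And>b. b \<in> \<C> \<Longrightarrow> openin \<tau> b" unfolding \<C>_def using B(2) by auto
          ultimately obtain F where F: "finite F" "F \<subseteq> \<C>" "K \<subseteq> \<Union>F"
            using K unfolding compactin_def by metis
          then have "\<Union>F \<in> \<K>" unfolding \<K>_def \<U>_def \<C>_def by auto
          then obtain i where "c i = \<Union>F" using c by (metis rangeE)
          moreover have "x \<in> c i" using x unfolding Z_def by auto
          ultimately show False using F(2) unfolding \<C>_def by auto
        qed
      qed
    qed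
    \<comment> \<open>Continuity from above applies because all \<open>Z m\<close> lie in
      \<open>O' n\<close>, which has finite measure.\<close>
    have "(\<lambda>m. measure \<mu> (Z m)) \<longlonglongrightarrow> measure \<mu> (\<Inter>m. Z m)"
    proof (rule Lim_measure_decseq)
      show "range Z \<subseteq> sets \<mu>" using Zop open_sets by auto
      show "decseq Z" unfolding Z_def by (fastforce simp: decseq_def)
      show "emeasure \<mu> (Z i) \<noteq> \<infinity>" for i using ZfM[of i] by (auto simp: fmeasurable_def)
    qed
    then have "\<forall>\<^sub>F m in sequentially. measure \<mu> (Z m) < measure \<mu> K + e"
      unfolding Zint by (rule order_tendstoD) (use e in simp)
    then obtain m where m: "measure \<mu> (Z m) < measure \<mu> K + e"
      by (auto simp: eventually_sequentially)
    have "Z m \<in> \<D>"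
    proof -
      have "Z m = O' n \<inter> \<Inter>((c ` {..m}) - {topspace \<tau>})"
        using openin_subset[OF O'(1)[of n]] unfolding Z_def by auto
      moreover have "(c ` {..m}) - {topspace \<tau>} \<subseteq> \<U>" using c unfolding \<K>_def by blast
      ultimately show ?thesis unfolding \<D>_def by (auto intro!: image_eqI[where x="((c ` {..m}) - {topspace \<tau>}, n)"])
    qed
    then show "\<exists>W\<in>\<D>. K \<subseteq> W \<and> W \<in> fmeasurable \<mu> \<and> measure \<mu> W < measure \<mu> K + e"
      using KZ ZfM m by blast
  qed
qed

text \<open>No continuity of \<open>F\<close> in its parameter is available, so density is meant in
  the metric of symmetric differences. Two members that lie in a common set W and nearly fill it
  differ by little; hence one member for each W of the countable outer family and each tolerance is
  enough.\<close>

lemma compact_family_separable: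
  assumes F: "\<And>s. s \<in> I \<Longrightarrow> compactin \<tau> (F s)"
  obtains D where "countable D" "D \<subseteq> I"
    "\<And>s e. s \<in> I \<Longrightarrow> e > 0 \<Longrightarrow> \<exists>t\<in>D. measure \<mu> (sym_diff (F s) (F t)) < e"
proof -
  obtain \<D> where \<D>: "countable \<D>" "\<D> \<subseteq> sets \<mu>"
    "\<And>K e. compactin \<tau> K \<Longrightarrow> e > 0 \<Longrightarrow> \<exists>W\<in>\<D>. K \<subseteq> W \<and> W \<in> fmeasurable \<mu> \<and> measure \<mu> W < measure \<mu> K + e"
    using compact_outer_approx by blast
  define P where "P W j s \<longleftrightarrow> s \<in> I \<and> F s \<subseteq> W \<and> W \<in> fmeasurable \<mu> \<and> measure \<mu> W < measure \<mu> (F s) + 1 / real (Suc j)" for W j s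
  define pick where "pick = (\<lambda>(W, j). SOME s. P W j s)"
  define D where "D = pick ` {(W, j). W \<in> \<D> \<and> (\<exists>s. P W j s)}"
  have pick: "P W j (pick (W, j))" if "P W j s" for W j s
    unfolding pick_def using that by (auto intro: someI)
  show thesis
  proof
    show "countable D" unfolding D_def
      by (rule countable_image, rule countable_subset[of _ "\<D> \<times> UNIV"]) (use \<D>(1) in auto)
    show "D \<subseteq> I" unfolding D_def using pick by (auto simp: P_def)
    fix s and e :: real assume s: "s \<in> I" and e: "e > 0"
    \<comment> \<open>Half of e, because the parts of W missed by \<open>F s\<close> and by
      \<open>F t\<close> add up.\<close>
    obtain j where j: "1 / real (Suc j) < e / 2" using e by (metis half_gt_zero nat_approx_posE)
    obtain W where W: "W \<in> \<D>" "P W j s"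
      using \<D>(3)[OF F[OF s], of "1 / real (Suc j)"] s unfolding P_def by auto
    define t where "t = pick (W, j)"
    have t: "P W j t" unfolding t_def using W by (rule_tac pick)
    have tD: "t \<in> D" unfolding t_def D_def using W by auto
    have fm: "F s \<in> fmeasurable \<mu>" "F t \<in> fmeasurable \<mu>" "W \<in> fmeasurable \<mu>"
      using F s t compact_fmeasurable by (auto simp: P_def)
    have "measure \<mu> (sym_diff (F s) (F t)) \<le> measure \<mu> ((W - F t) \<union> (W - F s))"
      using W t fm by (intro measure_mono_fmeasurable) (auto simp: P_def)
    also have "\<dots> \<le> measure \<mu> (W - F t) + measure \<mu> (W - F s)"
      using fm by (intro measure_Un_le) auto
    also have "\<dots> = (measure \<mu> W - measure \<mu> (F t)) + (measure \<mu> W - measure \<mu> (F s))"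
      using fm W t by (subst (1 2) measurable_measure_Diff) (auto simp: P_def)
    also have "\<dots> < e" using W(2) t j unfolding P_def by linarith
    finally show "\<exists>t\<in>D. measure \<mu> (sym_diff (F s) (F t)) < e" using tD by blast
  qed
qed

end

section \<open>Haar measures on products\<close>

lemma left_haar_lcsc_borel_measure:
  assumes "lcsc_group G \<tau>" "closedin \<tau> H" "left_haar G \<tau> H \<mu>"
  shows "lcsc_borel_measure (subtopology \<tau> H) \<mu>"
  using assms
  by unfold_locales (auto simp: lcsc_group_def left_haar_def Hausdorff_space_subtopology
    locally_compact_space_closed_subset second_countable_subtopology)

lemma translation_continuous:
  assumes "lcsc_group G \<tau>" "g \<in> carrier G"
  shows "continuous_map \<tau> \<tau> (\<lambda>x. g \<otimes>\<^bsub>G\<^esub> x)"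
proof -
  have "continuous_map \<tau> (prod_topology \<tau> \<tau>) (\<lambda>x. (g, x))"
    using assms by (auto simp: continuous_map_pairedI lcsc_group_def)
  moreover have "continuous_map (prod_topology \<tau> \<tau>) \<tau> (\<lambda>(x, y). x \<otimes>\<^bsub>G\<^esub> y)"
    using assms by (simp add: lcsc_group_def)
  ultimately have "continuous_map \<tau> \<tau> ((\<lambda>(x, y). x \<otimes>\<^bsub>G\<^esub> y) \<circ> (\<lambda>x. (g, x)))"
    by (rule continuous_map_compose)
  then show ?thesis by (simp add: comp_def)
qed

lemma translation_measurable:
  assumes G: "lcsc_group G \<tau>" and H: "subgroup H G" and "g \<in> H"
  shows "(\<lambda>x. g \<otimes>\<^bsub>G\<^esub> x) \<in> measurable (borel_of (subtopology \<tau> H)) (borel_of (subtopology \<tau> H))"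
proof (rule continuous_map_measurable_borel_of)
  have "continuous_map (subtopology \<tau> H) \<tau> (\<lambda>x. g \<otimes>\<^bsub>G\<^esub> x)"
    using translation_continuous[OF G] assms subgroup.mem_carrier[OF H] by (intro continuous_map_from_subtopology) auto
  then show "continuous_map (subtopology \<tau> H) (subtopology \<tau> H) (\<lambda>x. g \<otimes>\<^bsub>G\<^esub> x)"
    using assms subgroup.m_closed[OF H] by (intro continuous_map_into_subtopology) auto
qed

text \<open>Invariance of Haar measure is stated for images, whereas measurability and integration
  ask for preimages; translation by the inverse passes between them.\<close>

lemma translation_image_eq:
  assumes "group G" and H: "subgroup H G" and g: "g \<in> H" and A: "A \<subseteq> H"
  shows "(\<lambda>x. g \<otimes>\<^bsub>G\<^esub> x) ` A = {y \<in> H. inv\<^bsub>G\<^esub> g \<otimes>\<^bsub>G\<^esub> y \<in> A}"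
proof -
  interpret group G by fact
  have c: "x \<in> carrier G" if "x \<in> H" for x using that subgroup.mem_carrier[OF H] by simp
  show ?thesis
  proof (intro equalityI subsetI)
    fix y assume "y \<in> (\<lambda>x. g \<otimes>\<^bsub>G\<^esub> x) ` A"
    then obtain x where x: "x \<in> A" "y = g \<otimes>\<^bsub>G\<^esub> x" by blast
    have "inv\<^bsub>G\<^esub> g \<otimes>\<^bsub>G\<^esub> (g \<otimes>\<^bsub>G\<^esub> x) = x" using c[OF g] c[of x] x A by (auto simp flip: m_assoc)
    then show "y \<in> {y \<in> H. inv\<^bsub>G\<^esub> g \<otimes>\<^bsub>G\<^esub> y \<in> A}" using x A g subgroup.m_closed[OF H] by auto
  next
    fix y assume y: "y \<in> {y \<in> H. inv\<^bsub>G\<^esub> g \<otimes>\<^bsub>G\<^esub> y \<in> A}"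
    have "y = g \<otimes>\<^bsub>G\<^esub> (inv\<^bsub>G\<^esub> g \<otimes>\<^bsub>G\<^esub> y)" using c[OF g] c[of y] y by (auto simp flip: m_assoc)
    then show "y \<in> (\<lambda>x. g \<otimes>\<^bsub>G\<^esub> x) ` A" using y by blast
  qed
qed

lemma translation_image_sets:
  assumes G: "lcsc_group G \<tau>" and H: "subgroup H G" and g: "g \<in> H"
    and A: "A \<in> sets (borel_of (subtopology \<tau> H))"
  shows "(\<lambda>x. g \<otimes>\<^bsub>G\<^esub> x) ` A \<in> sets (borel_of (subtopology \<tau> H))"
proof -
  have sp: "space (borel_of (subtopology \<tau> H)) = H"
    using G subgroup.subset[OF H] by (auto simp: lcsc_group_def)
  have "(\<lambda>x. g \<otimes>\<^bsub>G\<^esub> x) ` A = (\<lambda>x. inv\<^bsub>G\<^esub> g \<otimes>\<^bsub>G\<^esub> x) -` A \<inter> space (borel_of (subtopology \<tau> H))"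
    using translation_image_eq[of G H g A] G H g sets.sets_into_space[OF A] sp by (auto simp: lcsc_group_def)
  also have "\<dots> \<in> sets (borel_of (subtopology \<tau> H))"
    using G H g A by (intro measurable_sets[OF translation_measurable[OF G H]] subgroup.m_inv_closed)
  finally show ?thesis .
qed

lemma left_haar_nn_integral_translation:
  assumes G: "lcsc_group G \<tau>" and H: "subgroup H G" and haar: "left_haar G \<tau> H \<mu>" and g: "g \<in> H"
    and \<phi>: "\<phi> \<in> borel_measurable \<mu>"
  shows "(\<integral>\<^sup>+x. \<phi> (g \<otimes>\<^bsub>G\<^esub> x) \<partial>\<mu>) = (\<integral>\<^sup>+x. \<phi> x \<partial>\<mu>)"
proof -
  have sets: "sets \<mu> = sets (borel_of (subtopology \<tau> H))" and sp: "space \<mu> = H"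
    using haar by (auto simp: left_haar_def)
  interpret group G using G by (simp add: lcsc_group_def)
  have m: "(\<lambda>x. g \<otimes>\<^bsub>G\<^esub> x) \<in> measurable \<mu> \<mu>"
    using translation_measurable[OF G H g] by (simp add: sets cong: measurable_cong_sets)
  have "distr \<mu> \<mu> (\<lambda>x. g \<otimes>\<^bsub>G\<^esub> x) = \<mu>"
  proof (rule measure_eqI)
    fix A assume "A \<in> sets (distr \<mu> \<mu> (\<lambda>x. g \<otimes>\<^bsub>G\<^esub> x))"
    then have A: "A \<in> sets \<mu>" by simp
    have gi: "inv\<^bsub>G\<^esub> g \<in> H" "g \<in> carrier G" using g H by (auto simp: subgroup.m_inv_closed subgroup.mem_carrier)
    have "(\<lambda>x. g \<otimes>\<^bsub>G\<^esub> x) -` A \<inter> space \<mu> = (\<lambda>x. inv\<^bsub>G\<^esub> g \<otimes>\<^bsub>G\<^esub> x) ` A"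
      using translation_image_eq[OF _ H gi(1), of A] sets.sets_into_space[OF A] gi sp is_group by auto
    then show "emeasure (distr \<mu> \<mu> (\<lambda>x. g \<otimes>\<^bsub>G\<^esub> x)) A = emeasure \<mu> A"
      using haar gi A m by (simp add: emeasure_distr left_haar_def)
  qed simp
  then show ?thesis using nn_integral_distr[OF m, of \<phi>] \<phi> by simp
qed

text \<open>A set B is measured by integrating over u the measure of its slice, the set of v with uv
  in B. Translating B by an element of \<open>U\<close> moves the outer variable. Translating by v0
  in \<open>V\<close> keeps u: since v0 u v = u (inv u v0 u) v, the slice is moved by inv u v0 u,
  which lies in \<open>V\<close> by normality. The conjugate acts from the left, so left invariance
  of \<open>mV\<close> applies and no modular function appears.\<close>

lemma product_left_haar:
  assumes G: "lcsc_group G \<tau>" and U: "subgroup U G" "closedin \<tau> U" and V: "subgroup V G" "closedin \<tau> V" "normal V G"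
    and psi: "homeomorphic_map (prod_topology (subtopology \<tau> U) (subtopology \<tau> V)) \<tau> (\<lambda>(u, v). u \<otimes>\<^bsub>G\<^esub> v)"
    and mU: "left_haar G \<tau> U mU" and mV: "left_haar G \<tau> V mV"
  shows "(\<lambda>(u, v). u \<otimes>\<^bsub>G\<^esub> v) \<in> measurable (mU \<Otimes>\<^sub>M mV) (borel_of \<tau>)"
    and "left_haar G \<tau> (carrier G) (distr (mU \<Otimes>\<^sub>M mV) (borel_of \<tau>) (\<lambda>(u, v). u \<otimes>\<^bsub>G\<^esub> v))"
proof -
  interpret group G using G by (simp add: lcsc_group_def)
  interpret U: lcsc_borel_measure "subtopology \<tau> U" mU by (rule left_haar_lcsc_borel_measure[OF G U(2) mU])
  interpret V: lcsc_borel_measure "subtopology \<tau> V" mV by (rule left_haar_lcsc_borel_measure[OF G V(2) mV])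
  interpret mU: sigma_finite_measure mU by (rule U.sigma_finite)
  interpret mV: sigma_finite_measure mV by (rule V.sigma_finite)
  define \<psi> where "\<psi> = (\<lambda>(u, v). u \<otimes>\<^bsub>G\<^esub> v)"
  define \<nu> where "\<nu> = distr (mU \<Otimes>\<^sub>M mV) (borel_of \<tau>) \<psi>"
  let ?P = "prod_topology (subtopology \<tau> U) (subtopology \<tau> V)"
  have top: "topspace \<tau> = carrier G" using G by (simp add: lcsc_group_def)
  then have subt: "subtopology \<tau> (carrier G) = \<tau>" by (metis subtopology_topspace)
  have psi: "homeomorphic_map ?P \<tau> \<psi>" using psi by (simp add: \<psi>_def)
  have spU: "space mU = U" and spV: "space mV = V" using mU mV by (auto simp: left_haar_def)
  have topU: "topspace (subtopology \<tau> U) = U" "topspace (subtopology \<tau> V) = V"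
    using U.space_eq V.space_eq spU spV by auto
  have cU: "u \<in> carrier G" if "u \<in> U" for u using that subgroup.mem_carrier[OF U(1)] by simp
  have cV: "v \<in> carrier G" if "v \<in> V" for v using that subgroup.mem_carrier[OF V(1)] by simp
  have cont: "continuous_map ?P \<tau> \<psi>" using psi by (rule homeomorphic_imp_continuous_map)
  have sets_eq: "sets (mU \<Otimes>\<^sub>M mV) = sets (borel_of (subtopology \<tau> U) \<Otimes>\<^sub>M borel_of (subtopology \<tau> V))"
    by (rule sets_pair_measure_cong[OF U.sets_eq V.sets_eq])
  have \<psi>m: "\<psi> \<in> measurable (mU \<Otimes>\<^sub>M mV) (borel_of \<tau>)"
    using continuous_map_prod_measurable_borel_of[OF U.second_countable V.second_countable cont]
    by (simp add: sets_eq cong: measurable_cong_sets)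
  then show "(\<lambda>(u, v). u \<otimes>\<^bsub>G\<^esub> v) \<in> measurable (mU \<Otimes>\<^sub>M mV) (borel_of \<tau>)" by (simp add: \<psi>_def)
  have surj: "\<psi> ` (U \<times> V) = carrier G"
    using homeomorphic_imp_surjective_map[OF psi] top topU by simp
  define \<phi> where "\<phi> B u = emeasure mV {v \<in> V. u \<otimes>\<^bsub>G\<^esub> v \<in> B}" for B u
  have sl: "{v \<in> V. u \<otimes>\<^bsub>G\<^esub> v \<in> B} = Pair u -` (\<psi> -` B \<inter> space (mU \<Otimes>\<^sub>M mV))" if "u \<in> U" for u B
    using that by (auto simp: \<psi>_def space_pair_measure spU spV)
  have pre: "\<psi> -` B \<inter> space (mU \<Otimes>\<^sub>M mV) \<in> sets (mU \<Otimes>\<^sub>M mV)" if "B \<in> sets (borel_of \<tau>)" for B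
    using measurable_sets[OF \<psi>m that] .
  have slm: "{v \<in> V. u \<otimes>\<^bsub>G\<^esub> v \<in> B} \<in> sets mV" if "u \<in> U" "B \<in> sets (borel_of \<tau>)" for u B
    unfolding sl[OF that(1)] by (rule sets_Pair1[OF pre[OF that(2)]])
  have \<phi>m: "\<phi> B \<in> borel_measurable mU" if B: "B \<in> sets (borel_of \<tau>)" for B
    using mV.measurable_emeasure_Pair[OF pre[OF B]]
    by (rule measurable_cong[THEN iffD1, rotated]) (simp add: \<phi>_def sl spU)
  have \<nu>\<phi>: "emeasure \<nu> B = (\<integral>\<^sup>+u. \<phi> B u \<partial>mU)" if B: "B \<in> sets (borel_of \<tau>)" for B
  proof -
    have "emeasure \<nu> B = emeasure (mU \<Otimes>\<^sub>M mV) (\<psi> -` B \<inter> space (mU \<Otimes>\<^sub>M mV))"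
      unfolding \<nu>_def using \<psi>m B by (rule emeasure_distr)
    also have "\<dots> = (\<integral>\<^sup>+u. emeasure mV (Pair u -` (\<psi> -` B \<inter> space (mU \<Otimes>\<^sub>M mV))) \<partial>mU)"
      by (rule mV.emeasure_pair_measure_alt[OF pre[OF B]])
    also have "\<dots> = (\<integral>\<^sup>+u. \<phi> B u \<partial>mU)" by (rule nn_integral_cong) (simp add: \<phi>_def sl spU)
    finally show ?thesis .
  qed
  have tr: "(\<lambda>x. g \<otimes>\<^bsub>G\<^esub> x) ` B \<in> sets (borel_of \<tau>)" if "g \<in> carrier G" "B \<in> sets (borel_of \<tau>)" for g B
    using translation_image_sets[OF G subgroup_self that(1), of B] that(2) by (simp add: subt)
  have tri: "y \<in> (\<lambda>x. g \<otimes>\<^bsub>G\<^esub> x) ` B \<longleftrightarrow> inv\<^bsub>G\<^esub> g \<otimes>\<^bsub>G\<^esub> y \<in> B"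
    if "g \<in> carrier G" "B \<in> sets (borel_of \<tau>)" "y \<in> carrier G" for g B y
    using translation_image_eq[OF is_group subgroup_self that(1), of B] sets.sets_into_space[OF that(2)] that(3) top by auto
  have invV: "emeasure \<nu> ((\<lambda>x. v0 \<otimes>\<^bsub>G\<^esub> x) ` B) = emeasure \<nu> B" if v0: "v0 \<in> V" and B: "B \<in> sets (borel_of \<tau>)" for v0 B
  proof -
    have "\<phi> ((\<lambda>x. v0 \<otimes>\<^bsub>G\<^esub> x) ` B) u = \<phi> B u" if u: "u \<in> U" for u
    proof -
      define w where "w = inv\<^bsub>G\<^esub> u \<otimes>\<^bsub>G\<^esub> v0 \<otimes>\<^bsub>G\<^esub> u"
      have w: "w \<in> V" unfolding w_def using normal.inv_op_closed1[OF V(3) cU[OF u] v0] .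
      have "{v \<in> V. u \<otimes>\<^bsub>G\<^esub> v \<in> (\<lambda>x. v0 \<otimes>\<^bsub>G\<^esub> x) ` B} = {v \<in> V. inv\<^bsub>G\<^esub> w \<otimes>\<^bsub>G\<^esub> v \<in> {v \<in> V. u \<otimes>\<^bsub>G\<^esub> v \<in> B}}"
      proof (rule Collect_cong, rule conj_cong[OF refl])
        fix v assume v: "v \<in> V"
        have "u \<otimes>\<^bsub>G\<^esub> (inv\<^bsub>G\<^esub> w \<otimes>\<^bsub>G\<^esub> v) = inv\<^bsub>G\<^esub> v0 \<otimes>\<^bsub>G\<^esub> (u \<otimes>\<^bsub>G\<^esub> v)"
        proof -
          have "inv\<^bsub>G\<^esub> w = inv\<^bsub>G\<^esub> u \<otimes>\<^bsub>G\<^esub> inv\<^bsub>G\<^esub> v0 \<otimes>\<^bsub>G\<^esub> u"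
            unfolding w_def using cU[OF u] cV[OF v0] by (simp add: inv_mult_group m_assoc)
          then have "u \<otimes>\<^bsub>G\<^esub> (inv\<^bsub>G\<^esub> w \<otimes>\<^bsub>G\<^esub> v) = u \<otimes>\<^bsub>G\<^esub> (inv\<^bsub>G\<^esub> u \<otimes>\<^bsub>G\<^esub> (inv\<^bsub>G\<^esub> v0 \<otimes>\<^bsub>G\<^esub> (u \<otimes>\<^bsub>G\<^esub> v)))"
            using cU[OF u] cV[OF v0] cV[OF v] by (simp add: m_assoc)
          also have "\<dots> = (u \<otimes>\<^bsub>G\<^esub> inv\<^bsub>G\<^esub> u) \<otimes>\<^bsub>G\<^esub> (inv\<^bsub>G\<^esub> v0 \<otimes>\<^bsub>G\<^esub> (u \<otimes>\<^bsub>G\<^esub> v))"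
            using cU[OF u] cV[OF v0] cV[OF v] by (intro m_assoc[symmetric]) auto
          finally show ?thesis using cU[OF u] cV[OF v0] cV[OF v] by simp
        qed
        moreover have "inv\<^bsub>G\<^esub> w \<otimes>\<^bsub>G\<^esub> v \<in> V" using w v V(1) by (simp add: subgroup.m_closed subgroup.m_inv_closed)
        ultimately show "u \<otimes>\<^bsub>G\<^esub> v \<in> (\<lambda>x. v0 \<otimes>\<^bsub>G\<^esub> x) ` B \<longleftrightarrow> inv\<^bsub>G\<^esub> w \<otimes>\<^bsub>G\<^esub> v \<in> {v \<in> V. u \<otimes>\<^bsub>G\<^esub> v \<in> B}"
          using tri[OF cV[OF v0] B, of "u \<otimes>\<^bsub>G\<^esub> v"] cU[OF u] cV[OF v] by simp
      qed
      also have "\<dots> = (\<lambda>v. w \<otimes>\<^bsub>G\<^esub> v) ` {v \<in> V. u \<otimes>\<^bsub>G\<^esub> v \<in> B}"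
        by (rule translation_image_eq[symmetric, OF is_group V(1) w]) auto
      finally show ?thesis using mV w slm[OF u B] by (simp add: \<phi>_def left_haar_def)
    qed
    then have "(\<integral>\<^sup>+u. \<phi> ((\<lambda>x. v0 \<otimes>\<^bsub>G\<^esub> x) ` B) u \<partial>mU) = (\<integral>\<^sup>+u. \<phi> B u \<partial>mU)"
      by (intro nn_integral_cong) (simp add: spU)
    then show ?thesis using \<nu>\<phi>[OF B] \<nu>\<phi>[OF tr[OF cV[OF v0] B]] by simp
  qed
  have invU: "emeasure \<nu> ((\<lambda>x. u0 \<otimes>\<^bsub>G\<^esub> x) ` B) = emeasure \<nu> B" if u0: "u0 \<in> U" and B: "B \<in> sets (borel_of \<tau>)" for u0 B
  proof -
    have eq: "\<phi> ((\<lambda>x. u0 \<otimes>\<^bsub>G\<^esub> x) ` B) (u0 \<otimes>\<^bsub>G\<^esub> u) = \<phi> B u" if u: "u \<in> U" for u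
    proof -
      have "u0 \<otimes>\<^bsub>G\<^esub> u \<otimes>\<^bsub>G\<^esub> v \<in> (\<lambda>x. u0 \<otimes>\<^bsub>G\<^esub> x) ` B \<longleftrightarrow> u \<otimes>\<^bsub>G\<^esub> v \<in> B" if "v \<in> V" for v
      proof -
        have "inv\<^bsub>G\<^esub> u0 \<otimes>\<^bsub>G\<^esub> (u0 \<otimes>\<^bsub>G\<^esub> u \<otimes>\<^bsub>G\<^esub> v) = u \<otimes>\<^bsub>G\<^esub> v"
          using cU[OF u0] cU[OF u] cV[OF that] by (simp flip: m_assoc)
        then show ?thesis using tri[OF cU[OF u0] B, of "u0 \<otimes>\<^bsub>G\<^esub> u \<otimes>\<^bsub>G\<^esub> v"] cU[OF u0] cU[OF u] cV[OF that] by simp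
      qed
      then have "{v \<in> V. u0 \<otimes>\<^bsub>G\<^esub> u \<otimes>\<^bsub>G\<^esub> v \<in> (\<lambda>x. u0 \<otimes>\<^bsub>G\<^esub> x) ` B} = {v \<in> V. u \<otimes>\<^bsub>G\<^esub> v \<in> B}" by auto
      then show ?thesis by (simp add: \<phi>_def)
    qed
    have "(\<integral>\<^sup>+u. \<phi> ((\<lambda>x. u0 \<otimes>\<^bsub>G\<^esub> x) ` B) u \<partial>mU) = (\<integral>\<^sup>+u. \<phi> ((\<lambda>x. u0 \<otimes>\<^bsub>G\<^esub> x) ` B) (u0 \<otimes>\<^bsub>G\<^esub> u) \<partial>mU)"
      by (rule left_haar_nn_integral_translation[symmetric, OF G U(1) mU u0 \<phi>m[OF tr[OF cU[OF u0] B]]])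
    also have "\<dots> = (\<integral>\<^sup>+u. \<phi> B u \<partial>mU)" using eq by (intro nn_integral_cong) (simp add: spU)
    finally show ?thesis using \<nu>\<phi>[OF B] \<nu>\<phi>[OF tr[OF cU[OF u0] B]] by simp
  qed
  have "left_haar G \<tau> (carrier G) \<nu>" unfolding left_haar_def subt
  proof (intro conjI allI impI ballI)
    show "sets \<nu> = sets (borel_of \<tau>)" "space \<nu> = carrier G" by (simp_all add: \<nu>_def top)
  next
    fix K assume K: "compactin \<tau> K"
    \<comment> \<open>The homeomorphism makes this preimage compact. It lies in the rectangle of its
      two projections, which are compact, and that rectangle has finite measure.\<close>
    define P where "P = \<psi> -` K \<inter> (U \<times> V)"
    have KG: "K \<subseteq> carrier G" using compactin_subset_topspace[OF K] top by simp
    have "\<psi> ` P = K \<inter> \<psi> ` (U \<times> V)" unfolding P_def by auto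
    then have "\<psi> ` P = K" using surj KG by (simp add: Int_absorb2)
    then have "compactin ?P P"
      using K homeomorphic_map_compactness[OF psi, of P] topU by (simp add: P_def)
    then have c: "compactin (subtopology \<tau> U) (fst ` P)" "compactin (subtopology \<tau> V) (snd ` P)"
      by (auto intro: image_compactin continuous_map_fst continuous_map_snd)
    have Ks: "K \<in> sets (borel_of \<tau>)" using K G by (auto simp: lcsc_group_def intro: borel_of_closed compactin_imp_closedin)
    have "emeasure \<nu> K = emeasure (mU \<Otimes>\<^sub>M mV) P"
      unfolding \<nu>_def P_def using emeasure_distr[OF \<psi>m Ks] by (simp add: space_pair_measure spU spV)
    also have "\<dots> \<le> emeasure (mU \<Otimes>\<^sub>M mV) (fst ` P \<times> snd ` P)"
      using U.compact_sets[OF c(1)] V.compact_sets[OF c(2)] by (intro emeasure_mono) force+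
    also have "\<dots> = emeasure mU (fst ` P) * emeasure mV (snd ` P)"
      using U.compact_sets[OF c(1)] V.compact_sets[OF c(2)] by (rule mV.emeasure_pair_measure_Times)
    also have "\<dots> < \<infinity>" using U.compact_finite[OF c(1)] V.compact_finite[OF c(2)] by (simp add: ennreal_mult_less_top)
    finally show "emeasure \<nu> K < \<infinity>" .
  next
    fix W assume W: "openin \<tau> W \<and> W \<noteq> {}"
    define P where "P = \<psi> -` W \<inter> (U \<times> V)"
    have Pe: "P = {z \<in> topspace ?P. \<psi> z \<in> W}" using topU by (auto simp: P_def)
    have op: "openin ?P P" unfolding Pe using W cont by (intro openin_continuous_map_preimage) auto
    obtain w where w: "w \<in> W" using W by blast
    then have "w \<in> \<psi> ` (U \<times> V)" using surj openin_subset[of \<tau> W] W top by auto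
    then obtain u v where uv: "(u, v) \<in> P" using w by (auto simp: P_def)
    \<comment> \<open>A nonempty open rectangle inside the preimage has as its measure a product of
      two positive numbers.\<close>
    obtain U1 V1 where b: "openin (subtopology \<tau> U) U1" "openin (subtopology \<tau> V) V1" "u \<in> U1" "v \<in> V1" "U1 \<times> V1 \<subseteq> P"
      using op[unfolded openin_prod_topology_alt, rule_format, OF uv] by auto
    have Ws: "W \<in> sets (borel_of \<tau>)" using W by (auto intro: borel_of_open)
    have Ps: "P \<in> sets (mU \<Otimes>\<^sub>M mV)" using pre[OF Ws] by (simp add: P_def space_pair_measure spU spV)
    have "0 < emeasure mU U1 * emeasure mV V1"
      using b mU mV by (auto simp: left_haar_def ennreal_zero_less_mult_iff)
    also have "\<dots> = emeasure (mU \<Otimes>\<^sub>M mV) (U1 \<times> V1)"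
      using U.open_sets[OF b(1)] V.open_sets[OF b(2)] by (rule mV.emeasure_pair_measure_Times[symmetric])
    also have "\<dots> \<le> emeasure (mU \<Otimes>\<^sub>M mV) P" by (rule emeasure_mono[OF b(5) Ps])
    also have "\<dots> = emeasure \<nu> W"
      unfolding \<nu>_def P_def using emeasure_distr[OF \<psi>m Ws] by (simp add: space_pair_measure spU spV)
    finally show "0 < emeasure \<nu> W" .
  next
    fix h A assume h: "h \<in> carrier G" and "A \<in> sets \<nu>"
    then have A: "A \<in> sets (borel_of \<tau>)" by (simp add: \<nu>_def)
    have "h \<in> \<psi> ` (U \<times> V)" using h surj by simp
    \<comment> \<open>Every element of \<open>G\<close> factors as uv, so invariance under the two
      subgroups yields invariance under \<open>G\<close>.\<close>
    then obtain u v where uv: "u \<in> U" "v \<in> V" "h = u \<otimes>\<^bsub>G\<^esub> v" by (auto simp: \<psi>_def)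
    have "A \<subseteq> carrier G" using sets.sets_into_space[OF A] top by simp
    then have "(\<lambda>x. h \<otimes>\<^bsub>G\<^esub> x) ` A = (\<lambda>x. u \<otimes>\<^bsub>G\<^esub> x) ` (\<lambda>x. v \<otimes>\<^bsub>G\<^esub> x) ` A"
      unfolding image_image uv(3) using cU[OF uv(1)] cV[OF uv(2)] by (intro image_cong) (auto simp: m_assoc)
    then show "emeasure \<nu> ((\<lambda>x. h \<otimes>\<^bsub>G\<^esub> x) ` A) = emeasure \<nu> A"
      using invU[OF uv(1) tr[OF cV[OF uv(2)] A]] invV[OF uv(2) A] by simp
  qed
  then show "left_haar G \<tau> (carrier G) (distr (mU \<Otimes>\<^sub>M mV) (borel_of \<tau>) (\<lambda>(u, v). u \<otimes>\<^bsub>G\<^esub> v))"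
    by (simp add: \<nu>_def \<psi>_def)
qed

section \<open>Actions and their averages\<close>

text \<open>The invariant sets already form a sigma-algebra, so generating from them adds nothing:
  every member is invariant at each point and not merely up to a null set.\<close>

lemma sets_invariant_sigma:
  assumes "\<And>g. g \<in> H \<Longrightarrow> a g \<in> measurable X X"
  shows "sets (invariant_sigma H X a) = {A \<in> sets X. \<forall>g\<in>H. a g -` A \<inter> space X = A}" (is "_ = ?I")
proof -
  have "sigma_algebra (space X) ?I"
    unfolding sigma_algebra_iff2
  proof (intro conjI ballI allI impI)
    show "?I \<subseteq> Pow (space X)" by (auto dest: sets.sets_into_space)
    show "{} \<in> ?I" by auto
    show "space X - s \<in> ?I" if s: "s \<in> ?I" for s
    proof -
      have "a g -` (space X - s) \<inter> space X = space X - s" if g: "g \<in> H" for g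
      proof -
        have "a g -` s \<inter> space X = s" using s g by blast
        moreover have "a g x \<in> space X" if "x \<in> space X" for x
          using measurable_space[OF assms[OF g] that] .
        ultimately show ?thesis by blast
      qed
      then show ?thesis using s by auto
    qed
    show "(\<Union>i. A i) \<in> ?I" if A: "range A \<subseteq> ?I" for A :: "nat \<Rightarrow> 'b set"
    proof -
      have "a g -` (\<Union>i. A i) \<inter> space X = (\<Union>i. A i)" if g: "g \<in> H" for g
      proof -
        have "a g -` A i \<inter> space X = A i" for i using A g by blast
        then show ?thesis by blast
      qed
      moreover have "(\<Union>i. A i) \<in> sets X" using A by (intro sets.countable_UN) auto
      ultimately show ?thesis by auto
    qed
  qed
  then show ?thesis
    unfolding invariant_sigma_def using sets.space_closed[of X]
    by (subst sets_measure_of) (auto simp only: sigma_algebra.sigma_sets_eq)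
qed

text \<open>Points are Borel sets of the reals, so the level set of f through x is measurable and
  hence strictly invariant; it contains x and therefore also \<open>a g x\<close>.\<close>

lemma invariant_sigma_invariant:
  fixes f :: "'x \<Rightarrow> real"
  assumes meas: "\<And>g. g \<in> H \<Longrightarrow> a g \<in> measurable X X"
    and f: "f \<in> borel_measurable (invariant_sigma H X a)" and "g \<in> H" "x \<in> space X"
  shows "f (a g x) = f x"
proof -
  have sp: "space (invariant_sigma H X a) = space X"
    unfolding invariant_sigma_def by (rule space_measure_of) (auto dest: sets.sets_into_space)
  define S where "S = f -` {f x} \<inter> space X"
  have "S \<in> sets (invariant_sigma H X a)"
    using measurable_sets[OF f, of "{f x}"] by (simp add: sp S_def)
  moreover have "sets (invariant_sigma H X a) = {A \<in> sets X. \<forall>g\<in>H. a g -` A \<inter> space X = A}"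
    by (rule sets_invariant_sigma) (rule meas)
  ultimately have "a g -` S \<inter> space X = S" using \<open>g \<in> H\<close> by simp
  moreover have "x \<in> S" using \<open>x \<in> space X\<close> by (simp add: S_def)
  ultimately have "a g x \<in> S" by auto
  then show ?thesis by (simp add: S_def)
qed

section \<open>Functions in L^p\<close>

lemma Lp_fun_measurable: "Lp_fun p X f \<Longrightarrow> f \<in> borel_measurable X"
  by (simp add: Lp_fun_def)

lemma Lp_fun_iff:
  "Lp_fun p X f \<longleftrightarrow> f \<in> borel_measurable X \<and> (\<integral>\<^sup>+x. ennreal (\<bar>f x\<bar> powr p) \<partial>X) < \<infinity>"
  unfolding Lp_fun_def integrable_iff_bounded by auto

lemma Lp_fun_bound:
  assumes "Lp_fun p X g" "f \<in> borel_measurable X" "AE x in X. \<bar>f x\<bar> \<le> \<bar>g x\<bar>" "p > 0"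
  shows "Lp_fun p X f"
proof -
  have "(\<integral>\<^sup>+x. ennreal (\<bar>f x\<bar> powr p) \<partial>X) \<le> (\<integral>\<^sup>+x. ennreal (\<bar>g x\<bar> powr p) \<partial>X)"
    using assms by (intro nn_integral_mono_AE) (auto elim!: eventually_mono intro!: ennreal_leI powr_mono2)
  then show ?thesis using assms by (auto simp: Lp_fun_iff intro: le_less_trans)
qed

lemma powr_add_le:
  fixes x y p :: real
  assumes "x \<ge> 0" "y \<ge> 0" "p > 0"
  shows "(x + y) powr p \<le> 2 powr p * (x powr p + y powr p)"
proof -
  have "(x + y) powr p \<le> (2 * max x y) powr p" using assms by (intro powr_mono2) auto
  also have "\<dots> = 2 powr p * max x y powr p" using assms by (intro powr_mult)
  also have "max x y powr p \<le> x powr p + y powr p" by (auto simp: max_def)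
  finally show ?thesis by simp
qed

text \<open>A quasi-triangle inequality in place of Minkowski's: the factor \<open>2 powr p\<close>
  is harmless, since only finiteness and convergence to 0 are drawn from it.\<close>

lemma nn_integral_powr_add_le:
  fixes f g :: "'x \<Rightarrow> real"
  assumes [measurable]: "f \<in> borel_measurable X" "g \<in> borel_measurable X" and p: "p > 0"
  shows "(\<integral>\<^sup>+x. ennreal (\<bar>f x + g x\<bar> powr p) \<partial>X) \<le>
    ennreal (2 powr p) * ((\<integral>\<^sup>+x. ennreal (\<bar>f x\<bar> powr p) \<partial>X) + (\<integral>\<^sup>+x. ennreal (\<bar>g x\<bar> powr p) \<partial>X))"
proof -
  have "\<bar>f x + g x\<bar> powr p \<le> 2 powr p * (\<bar>f x\<bar> powr p + \<bar>g x\<bar> powr p)" for x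
    using powr_add_le[of "\<bar>f x\<bar>" "\<bar>g x\<bar>" p] powr_mono2[of p "\<bar>f x + g x\<bar>" "\<bar>f x\<bar> + \<bar>g x\<bar>"]
      p abs_triangle_ineq[of "f x" "g x"] by linarith
  then have "(\<integral>\<^sup>+x. ennreal (\<bar>f x + g x\<bar> powr p) \<partial>X) \<le>
    (\<integral>\<^sup>+x. ennreal (2 powr p) * (ennreal (\<bar>f x\<bar> powr p) + ennreal (\<bar>g x\<bar> powr p)) \<partial>X)"
    by (intro nn_integral_mono) (simp add: ennreal_leI flip: ennreal_mult' ennreal_plus)
  also have "\<dots> = ennreal (2 powr p) * ((\<integral>\<^sup>+x. ennreal (\<bar>f x\<bar> powr p) \<partial>X) + (\<integral>\<^sup>+x. ennreal (\<bar>g x\<bar> powr p) \<partial>X))"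
    by (simp add: nn_integral_cmult nn_integral_add)
  finally show ?thesis .
qed

lemma Lp_fun_add:
  assumes "Lp_fun p X f" "Lp_fun p X g" "p > 0"
  shows "Lp_fun p X (\<lambda>x. f x + g x)"
proof -
  have "(\<integral>\<^sup>+x. ennreal (\<bar>f x + g x\<bar> powr p) \<partial>X) < \<infinity>"
    using nn_integral_powr_add_le[of f X g p] assms
    by (auto simp: Lp_fun_iff ennreal_mult_less_top intro: le_less_trans)
  then show ?thesis using assms by (auto simp: Lp_fun_iff)
qed

lemma Lp_fun_uminus: "Lp_fun p X f \<Longrightarrow> Lp_fun p X (\<lambda>x. - f x)"
  by (simp add: Lp_fun_def)

lemma Lp_fun_abs: "Lp_fun p X f \<Longrightarrow> Lp_fun p X (\<lambda>x. \<bar>f x\<bar>)"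
  by (auto simp: Lp_fun_def)

lemma Lp_fun_diff: "Lp_fun p X f \<Longrightarrow> Lp_fun p X g \<Longrightarrow> p > 0 \<Longrightarrow> Lp_fun p X (\<lambda>x. f x - g x)"
  using Lp_fun_add[of p X f "\<lambda>x. - g x"] Lp_fun_uminus[of p X g] by simp

lemma (in finite_measure) Lp_fun_const: "Lp_fun p M (\<lambda>x. c)"
  by (simp add: Lp_fun_def)

lemma (in finite_measure) Lp_fun_integrable:
  assumes "Lp_fun p M f" "p > 1" shows "integrable M f"
proof (rule Bochner_Integration.integrable_bound)
  show "integrable M (\<lambda>x. 1 + \<bar>f x\<bar> powr p)" using assms by (simp add: Lp_fun_def)
  have "\<bar>y\<bar> \<le> 1 + \<bar>y\<bar> powr p" for y :: real
  proof (cases "\<bar>y\<bar> \<le> 1")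
    case False
    then have "\<bar>y\<bar> powr 1 \<le> \<bar>y\<bar> powr p" using assms by (intro powr_mono) auto
    then show ?thesis by (simp add: powr_one)
  qed (smt (verit) powr_ge_zero)
  then show "AE x in M. norm (f x) \<le> norm (1 + \<bar>f x\<bar> powr p)" by (auto simp: add_nonneg_nonneg)
qed (use assms in \<open>simp add: Lp_fun_def\<close>)

section \<open>Measure-preserving actions of a closed subgroup\<close>

locale haar_action =
  fixes G :: "('g, 'b) monoid_scheme" and \<tau> :: "'g topology" and H :: "'g set"
    and \<mu> :: "'g measure" and X :: "'x measure" and a :: "'g \<Rightarrow> 'x \<Rightarrow> 'x"
  assumes lcsc: "lcsc_group G \<tau>"
    and subgroup: "subgroup H G" and closed: "closedin \<tau> H"
    and haar: "left_haar G \<tau> H \<mu>"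
    and action: "mp_action G \<tau> H X a"
begin

sublocale group G
  using lcsc by (simp add: lcsc_group_def)

sublocale lcsc_borel_measure "subtopology \<tau> H" \<mu>
  by (rule left_haar_lcsc_borel_measure[OF lcsc closed haar])

sublocale X: prob_space X
  using action by (simp add: mp_action_def)

sublocale \<mu>: sigma_finite_measure \<mu>
  by (rule sigma_finite)

sublocale XM: pair_sigma_finite X \<mu> ..

lemma space_haar: "space \<mu> = H"
  using haar by (simp add: left_haar_def)

text \<open>Allows a statement free of the group variable to be extracted from its validity for
  almost every group element.\<close>

lemma haar_nonzero: "emeasure \<mu> H > 0"
proof -
  have "openin (subtopology \<tau> H) H" "H \<noteq> {}"
    using openin_topspace[of "subtopology \<tau> H"] space_eq space_haar subgroup.one_closed[OF subgroup] by auto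
  then show ?thesis using haar by (auto simp: left_haar_def)
qed

lemma action_measurable: "h \<in> H \<Longrightarrow> a h \<in> measurable X X"
  using action by (auto simp: mp_action_def)

lemma action_space: "h \<in> H \<Longrightarrow> x \<in> space X \<Longrightarrow> a h x \<in> space X"
  using measurable_space[OF action_measurable] .

lemma action_distr: "h \<in> H \<Longrightarrow> distr X X (a h) = X"
  using action by (auto simp: mp_action_def)

lemma inv_in: "h \<in> H \<Longrightarrow> inv\<^bsub>G\<^esub> h \<in> H"
  using subgroup by (simp add: subgroup.m_inv_closed)

lemma inv_measurable: "(\<lambda>h. inv\<^bsub>G\<^esub> h) \<in> measurable \<mu> (borel_of (subtopology \<tau> H))"
proof -
  have "continuous_map (subtopology \<tau> H) (subtopology \<tau> H) (\<lambda>h. inv\<^bsub>G\<^esub> h)"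
    using lcsc inv_in
    by (intro continuous_map_into_subtopology continuous_map_from_subtopology) (auto simp: lcsc_group_def)
  then have "(\<lambda>h. inv\<^bsub>G\<^esub> h) \<in> measurable (borel_of (subtopology \<tau> H)) (borel_of (subtopology \<tau> H))"
    by (rule continuous_map_measurable_borel_of)
  then show ?thesis using sets_eq by (simp cong: measurable_cong_sets)
qed

lemma inv_action_measurable: "(\<lambda>(h, x). a (inv\<^bsub>G\<^esub> h) x) \<in> measurable (\<mu> \<Otimes>\<^sub>M X) X"
proof -
  have "(\<lambda>(g, y). a g y) \<in> measurable (borel_of (subtopology \<tau> H) \<Otimes>\<^sub>M X) X"
    using action by (simp add: mp_action_def)
  moreover have "(\<lambda>(h, x). (inv\<^bsub>G\<^esub> h, x)) \<in> measurable (\<mu> \<Otimes>\<^sub>M X) (borel_of (subtopology \<tau> H) \<Otimes>\<^sub>M X)"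
    unfolding case_prod_beta
    by (intro measurable_Pair measurable_compose[OF measurable_fst inv_measurable] measurable_snd)
  ultimately have "(\<lambda>(g, y). a g y) \<circ> (\<lambda>(h, x). (inv\<^bsub>G\<^esub> h, x)) \<in> measurable (\<mu> \<Otimes>\<^sub>M X) X"
    by (rule measurable_comp[rotated])
  then show ?thesis by (simp add: comp_def case_prod_beta)
qed

lemma rep_measurable:
  assumes "f \<in> borel_measurable X"
  shows "(\<lambda>(h, x). rep G a h f x) \<in> borel_measurable (\<mu> \<Otimes>\<^sub>M X)"
  using measurable_compose[OF inv_action_measurable assms] by (simp add: rep_def case_prod_beta)

lemma rep_measurable_swap [measurable]:
  assumes "f \<in> borel_measurable X"
  shows "(\<lambda>(x, h). rep G a h f x) \<in> borel_measurable (X \<Otimes>\<^sub>M \<mu>)"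
  using measurable_compose[OF measurable_pair_swap' rep_measurable[OF assms]] by (simp add: case_prod_beta)

lemma rep_measurable_group:
  assumes "f \<in> borel_measurable X" "x \<in> space X"
  shows "(\<lambda>h. rep G a h f x) \<in> borel_measurable \<mu>"
  using measurable_Pair2[OF rep_measurable_swap[OF assms(1)] assms(2)] by simp

lemma nn_integral_action:
  assumes "h \<in> H" "\<phi> \<in> borel_measurable X"
  shows "(\<integral>\<^sup>+x. \<phi> (a (inv\<^bsub>G\<^esub> h) x) \<partial>X) = (\<integral>\<^sup>+x. \<phi> x \<partial>X)"
  using nn_integral_distr[OF action_measurable[OF inv_in[OF assms(1)]], of \<phi>]
    action_distr[OF inv_in[OF assms(1)]] assms(2) by simp

text \<open>Each map \<open>a (inv h)\<close> preserves the measure, so by Tonelli the set of h that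
  carry x into a given null set is itself null for almost every x. The exceptional h depend on
  x.\<close>

lemma AE_action:
  assumes "AE x in X. P x"
  shows "AE x in X. AE h in \<mu>. P (a (inv\<^bsub>G\<^esub> h) x)"
proof -
  obtain N where N: "N \<in> null_sets X" "{x \<in> space X. \<not> P x} \<subseteq> N"
    using assms by (auto simp: eventually_ae_filter)
  have [measurable]: "N \<in> sets X" using N by auto
  define \<phi> where "\<phi> = (indicator N :: 'x \<Rightarrow> ennreal)"
  have m: "(\<lambda>(h, x). \<phi> (a (inv\<^bsub>G\<^esub> h) x)) \<in> borel_measurable (\<mu> \<Otimes>\<^sub>M X)"
    using measurable_compose[OF inv_action_measurable, of \<phi> borel] by (simp add: case_prod_beta \<phi>_def)
  then have m': "(\<lambda>(x, h). \<phi> (a (inv\<^bsub>G\<^esub> h) x)) \<in> borel_measurable (X \<Otimes>\<^sub>M \<mu>)"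
    using measurable_compose[OF measurable_pair_swap' m] by (simp add: case_prod_beta)
  have "(\<integral>\<^sup>+x. (\<integral>\<^sup>+h. \<phi> (a (inv\<^bsub>G\<^esub> h) x) \<partial>\<mu>) \<partial>X) = (\<integral>\<^sup>+h. (\<integral>\<^sup>+x. \<phi> (a (inv\<^bsub>G\<^esub> h) x) \<partial>X) \<partial>\<mu>)"
    by (rule XM.Fubini'[symmetric]) (rule m')
  also have "\<dots> = (\<integral>\<^sup>+h. 0 \<partial>\<mu>)"
    by (rule nn_integral_cong) (use N in \<open>simp add: nn_integral_action space_haar \<phi>_def null_setsD1\<close>)
  finally have "AE x in X. (\<integral>\<^sup>+h. \<phi> (a (inv\<^bsub>G\<^esub> h) x) \<partial>\<mu>) = 0"
    using nn_integral_0_iff_AE[OF \<mu>.borel_measurable_nn_integral[OF m']] by simp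
  with AE_space show ?thesis
  proof eventually_elim
    case (elim x)
    have "AE h in \<mu>. \<phi> (a (inv\<^bsub>G\<^esub> h) x) = 0"
      using elim(2) nn_integral_0_iff_AE[OF measurable_Pair2[OF m' elim(1)]] by simp
    with AE_space show ?case
    proof eventually_elim
      case (elim h)
      then have "a (inv\<^bsub>G\<^esub> h) x \<in> space X" "a (inv\<^bsub>G\<^esub> h) x \<notin> N"
        using action_space[OF inv_in \<open>x \<in> space X\<close>, of h] by (auto simp: \<phi>_def space_haar)
      then show ?case using N(2) by auto
    qed
  qed
qed

text \<open>The exceptional null set is independent of the compact set, because a countable family of open
  sets of finite measure absorbs all compact sets.\<close>
lemma AE_set_integrable_rep:
  assumes f: "integrable X f"
  shows "AE x in X. \<forall>K. compactin (subtopology \<tau> H) K \<longrightarrow> set_integrable \<mu> K (\<lambda>h. rep G a h f x)"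
proof -
  have [measurable]: "f \<in> borel_measurable X" using f by auto
  obtain W :: "nat \<Rightarrow> 'g set" where W: "\<And>n. openin (subtopology \<tau> H) (W n)" "\<And>n. emeasure \<mu> (W n) < \<infinity>"
    "\<And>K. compactin (subtopology \<tau> H) K \<Longrightarrow> \<exists>n. K \<subseteq> W n" by (rule open_exhaustion) metis
  have "AE x in X. set_integrable \<mu> (W n) (\<lambda>h. rep G a h f x)" for n
  proof -
    have [measurable]: "W n \<in> sets \<mu>" using open_sets[OF W(1)] .
    have m: "(\<lambda>(x, h). indicator (W n) h * ennreal \<bar>rep G a h f x\<bar>) \<in> borel_measurable (X \<Otimes>\<^sub>M \<mu>)"
      by measurable
    \<comment> \<open>Tonelli and invariance of the measure give the mean over x of the orbit
      integral: the measure of \<open>W n\<close> times the L^1 norm of f, which is finite.\<close>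
    have "(\<integral>\<^sup>+x. (\<integral>\<^sup>+h. indicator (W n) h * ennreal \<bar>rep G a h f x\<bar> \<partial>\<mu>) \<partial>X)
        = (\<integral>\<^sup>+h. (\<integral>\<^sup>+x. indicator (W n) h * ennreal \<bar>rep G a h f x\<bar> \<partial>X) \<partial>\<mu>)"
      using XM.Fubini'[OF m] by simp
    also have "\<dots> = (\<integral>\<^sup>+h. indicator (W n) h * (\<integral>\<^sup>+x. ennreal \<bar>f x\<bar> \<partial>X) \<partial>\<mu>)"
    proof (rule nn_integral_cong)
      fix h assume h: "h \<in> space \<mu>"
      then have hH: "h \<in> H" by (simp add: space_haar)
      have [measurable]: "(\<lambda>x. rep G a h f x) \<in> borel_measurable X"
        using measurable_Pair2[OF rep_measurable h, of f] by simp
      have "(\<integral>\<^sup>+x. ennreal \<bar>rep G a h f x\<bar> \<partial>X) = (\<integral>\<^sup>+x. ennreal \<bar>f x\<bar> \<partial>X)"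
        using nn_integral_action[OF hH, of "\<lambda>x. ennreal \<bar>f x\<bar>"] by (simp add: rep_def)
      then show "(\<integral>\<^sup>+x. indicator (W n) h * ennreal \<bar>rep G a h f x\<bar> \<partial>X) = indicator (W n) h * (\<integral>\<^sup>+x. ennreal \<bar>f x\<bar> \<partial>X)"
        by (simp add: nn_integral_cmult)
    qed
    also have "\<dots> = emeasure \<mu> (W n) * (\<integral>\<^sup>+x. ennreal \<bar>f x\<bar> \<partial>X)"
      by (simp add: nn_integral_multc)
    also have "\<dots> < \<infinity>" using f W(2)[of n] by (simp add: ennreal_mult_less_top integrable_iff_bounded)
    finally have "AE x in X. (\<integral>\<^sup>+h. indicator (W n) h * ennreal \<bar>rep G a h f x\<bar> \<partial>\<mu>) \<noteq> \<infinity>"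
      using \<mu>.borel_measurable_nn_integral[OF m] by (intro nn_integral_PInf_AE) auto
    with AE_space show ?thesis
    proof eventually_elim
      case (elim x)
      have [measurable]: "(\<lambda>h. rep G a h f x) \<in> borel_measurable \<mu>" by (rule rep_measurable_group) (use elim in auto)
      show ?case unfolding set_integrable_def integrable_iff_bounded
        using elim(2) by (auto simp: less_top abs_mult indicator_mult_ennreal ennreal_mult mult.commute)
    qed
  qed
  then have "AE x in X. \<forall>n. set_integrable \<mu> (W n) (\<lambda>h. rep G a h f x)"
    by (simp add: AE_all_countable)
  then show ?thesis
  proof eventually_elim
    case (elim x)
    then show ?case using W(3) compact_sets by (meson set_integrable_subset)
  qed
qed

lemma avg_measurable [measurable]:
  assumes [measurable]: "f \<in> borel_measurable X" "K \<in> sets \<mu>"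
  shows "avg G \<mu> K a f \<in> borel_measurable X"
  unfolding avg_def[abs_def] set_lebesgue_integral_def by measurable

text \<open>If f is not measurable along the orbit of x, its integral is 0 by convention, and the
  bound survives because the dominating integrand is nonnegative.\<close>

lemma avg_le:
  assumes "set_integrable \<mu> K (\<lambda>h. rep G a h g x)" "K \<in> sets \<mu>"
    and "AE h in \<mu>. h \<in> K \<longrightarrow> \<bar>rep G a h f x\<bar> \<le> rep G a h g x"
  shows "\<bar>avg G \<mu> K a f x\<bar> \<le> avg G \<mu> K a g x"
proof -
  have ae: "AE h in \<mu>. norm (indicat_real K h *\<^sub>R rep G a h f x) \<le> indicat_real K h *\<^sub>R rep G a h g x"
    using assms(3) by eventually_elim (auto simp: indicator_def)
  have "norm (LINT h:K|\<mu>. rep G a h f x) \<le> (\<integral>h. norm (indicat_real K h *\<^sub>R rep G a h f x) \<partial>\<mu>)"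
    unfolding set_lebesgue_integral_def by (rule integral_norm_bound)
  also have "\<dots> \<le> (LINT h:K|\<mu>. rep G a h g x)"
    unfolding set_lebesgue_integral_def
  proof (rule integral_mono_AE'[OF _ ae])
    show "integrable \<mu> (\<lambda>h. indicat_real K h *\<^sub>R rep G a h g x)" using assms(1) by (simp add: set_integrable_def)
    show "AE h in \<mu>. 0 \<le> indicat_real K h *\<^sub>R rep G a h g x"
      using ae by eventually_elim (rule order_trans[OF norm_ge_zero])
  qed
  finally have "\<bar>LINT h:K|\<mu>. rep G a h f x\<bar> \<le> (LINT h:K|\<mu>. rep G a h g x)" by simp
  then show ?thesis by (simp add: avg_def divide_right_mono)
qed

end

text \<open>At each point the difference vanishes as soon as n reaches the absolute value of f
  there, and the p-th power of that absolute value dominates throughout.\<close>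

lemma Lp_truncation_tendsto:
  fixes f :: "'x \<Rightarrow> real"
  assumes [measurable]: "f \<in> borel_measurable X" and int: "integrable X (\<lambda>x. \<bar>f x\<bar> powr p)" and p: "p > 0"
  shows "(\<lambda>n. \<integral>x. \<bar>f x - max (- real n) (min (real n) (f x))\<bar> powr p \<partial>X) \<longlonglongrightarrow> 0"
proof -
  have "(\<lambda>n. \<integral>x. \<bar>f x - max (- real n) (min (real n) (f x))\<bar> powr p \<partial>X) \<longlonglongrightarrow> (\<integral>x. 0 \<partial>X)"
  proof (rule integral_dominated_convergence[where w="\<lambda>x. \<bar>f x\<bar> powr p"])
    show "AE x in X. (\<lambda>n. \<bar>f x - max (- real n) (min (real n) (f x))\<bar> powr p) \<longlonglongrightarrow> 0"
    proof (rule AE_I2)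
      fix x
      obtain m where m: "\<bar>f x\<bar> \<le> real m" using real_arch_simple by blast
      have "\<bar>f x - max (- real n) (min (real n) (f x))\<bar> powr p = 0" if "n \<ge> m" for n
        using m that by (auto simp: max_def min_def abs_le_iff)
      then show "(\<lambda>n. \<bar>f x - max (- real n) (min (real n) (f x))\<bar> powr p) \<longlonglongrightarrow> 0"
        by (intro tendsto_eventually) (auto simp: eventually_sequentially)
    qed
    show "AE x in X. norm (\<bar>f x - max (- real n) (min (real n) (f x))\<bar> powr p) \<le> \<bar>f x\<bar> powr p" for n
      using p by (intro AE_I2) (auto intro!: powr_mono2 simp: max_def min_def abs_if)
  qed (use int in auto)
  then show ?thesis by simp
qed

section \<open>Averages subject to a maximal inequality and a pointwise theorem\<close>

locale ergodic_averages = haar_action +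
  fixes E :: "real \<Rightarrow> 'a set"
  assumes compact_E: "\<And>T. T > 0 \<Longrightarrow> compactin (subtopology \<tau> H) (E T)"
    and positive_E: "\<And>T. T > 0 \<Longrightarrow> emeasure \<mu> (E T) > 0"
    and maximal: "\<And>p. p > 1 \<Longrightarrow> strong_maximal_ineq G \<mu> E p X a"
    and pointwise: "\<And>p. p > 1 \<Longrightarrow> pointwise_ergodic_thm G H \<mu> E p X a"
begin

abbreviation "A T f x \<equiv> avg G \<mu> (E T) a f x"
abbreviation "inv_exp \<equiv> real_cond_exp X (invariant_sigma H X a)"

lemma E_fmeasurable: "T > 0 \<Longrightarrow> E T \<in> fmeasurable \<mu>"
  by (simp add: compact_E compact_fmeasurable)

lemma E_sets: "T > 0 \<Longrightarrow> E T \<in> sets \<mu>"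
  by (simp add: compact_E compact_sets)

lemma E_subset: "T > 0 \<Longrightarrow> E T \<subseteq> H"
  using compact_E[of T] by (simp add: compactin_subtopology)

lemma measure_E_pos: "T > 0 \<Longrightarrow> measure \<mu> (E T) > 0"
  using positive_E[of T] E_fmeasurable[of T] by (simp add: fmeasurableD2 emeasure_eq_ennreal_measure)

lemma invariant_subalgebra: "sigma_finite_subalgebra X (invariant_sigma H X a)"
proof -
  have "subalgebra X (invariant_sigma H X a)"
    unfolding subalgebra_def using sets_invariant_sigma[of H a X] action_measurable
    by (auto simp: invariant_sigma_def space_measure_of_conv)
  then show ?thesis
    by (intro finite_measure_subalgebra_is_sigma_finite finite_measure_subalgebra.intro
      finite_measure_subalgebra_axioms.intro X.finite_measure_axioms)
qed

sublocale I: sigma_finite_subalgebra X "invariant_sigma H X a"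
  by (rule invariant_subalgebra)

text \<open>Valid at every point, because \<open>real_cond_exp\<close> is exactly measurable for the
  invariant sets. This is the strict invariance that the zero-one argument relies on.\<close>

lemma inv_exp_invariant: "g \<in> H \<Longrightarrow> x \<in> space X \<Longrightarrow> inv_exp f (a g x) = inv_exp f x"
  by (rule invariant_sigma_invariant[where H=H and X=X and a=a]) (auto intro: action_measurable)

text \<open>Besides the bound for the supremum it records the bound for each single T: the averages
  are bounded on L^p uniformly in T.\<close>

lemma maximal_constant:
  assumes "p > 1"
  obtains C :: real where "C \<ge> 0"
    "\<And>f. Lp_fun p X f \<Longrightarrow> (\<integral>\<^sup>+ y. (SUP T\<in>{0<..}. ennreal (\<bar>A T f y\<bar> powr p)) \<partial>X)
        \<le> ennreal C * (\<integral>\<^sup>+ y. ennreal (\<bar>f y\<bar> powr p) \<partial>X)"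
    "\<And>f T. Lp_fun p X f \<Longrightarrow> T > 0 \<Longrightarrow> (\<integral>\<^sup>+ y. ennreal (\<bar>A T f y\<bar> powr p) \<partial>X)
        \<le> ennreal C * (\<integral>\<^sup>+ y. ennreal (\<bar>f y\<bar> powr p) \<partial>X)"
proof -
  obtain C0 :: real where C0: "\<And>f. Lp_fun p X f \<Longrightarrow> (\<integral>\<^sup>+ y. (SUP T\<in>{0<..}. ennreal (\<bar>A T f y\<bar> powr p)) \<partial>X)
        \<le> ennreal C0 * (\<integral>\<^sup>+ y. ennreal (\<bar>f y\<bar> powr p) \<partial>X)"
    using maximal[OF assms] unfolding strong_maximal_ineq_def by blast
  \<comment> \<open>A negative constant is read as 0 by \<open>ennreal\<close>, so its positive part
    gives the same inequality.\<close>
  have C: "ennreal C0 = ennreal (max C0 0)" by (simp add: max_def ennreal_neg)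
  show thesis
  proof (rule that[of "max C0 0"])
    fix f assume f: "Lp_fun p X f"
    show *: "(\<integral>\<^sup>+ y. (SUP T\<in>{0<..}. ennreal (\<bar>A T f y\<bar> powr p)) \<partial>X)
        \<le> ennreal (max C0 0) * (\<integral>\<^sup>+ y. ennreal (\<bar>f y\<bar> powr p) \<partial>X)" using C0[OF f] by (simp only: C[symmetric])
    fix T :: real assume T: "T > 0"
    have "(\<integral>\<^sup>+ y. ennreal (\<bar>A T f y\<bar> powr p) \<partial>X) \<le> (\<integral>\<^sup>+ y. (SUP T\<in>{0<..}. ennreal (\<bar>A T f y\<bar> powr p)) \<partial>X)"
      using T by (intro nn_integral_mono SUP_upper) auto
    then show "(\<integral>\<^sup>+ y. ennreal (\<bar>A T f y\<bar> powr p) \<partial>X) \<le> ennreal (max C0 0) * (\<integral>\<^sup>+ y. ennreal (\<bar>f y\<bar> powr p) \<partial>X)"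
      using * by (rule order_trans)
  qed simp
qed

lemma avg_Lp:
  assumes "Lp_fun p X f" "p > 1" "T > 0" shows "Lp_fun p X (A T f)"
proof -
  obtain C where C: "(\<integral>\<^sup>+ y. ennreal (\<bar>A T f y\<bar> powr p) \<partial>X) \<le> ennreal C * (\<integral>\<^sup>+ y. ennreal (\<bar>f y\<bar> powr p) \<partial>X)"
    using maximal_constant[OF assms(2)] assms by metis
  also have "\<dots> < \<infinity>" using assms(1) by (simp add: Lp_fun_iff ennreal_mult_less_top)
  finally show ?thesis using assms E_sets by (simp add: Lp_fun_iff avg_measurable)
qed

lemma pointwise_AE:
  "Lp_fun p X f \<Longrightarrow> p > 1 \<Longrightarrow> AE y in X. ((\<lambda>T. A T f y) \<longlongrightarrow> inv_exp f y) at_top"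
  using pointwise[of p] by (simp add: pointwise_ergodic_thm_def)

lemma pointwise_Lp:
  "Lp_fun p X f \<Longrightarrow> p > 1 \<Longrightarrow>
    ((\<lambda>T. \<integral>\<^sup>+ y. ennreal (\<bar>A T f y - inv_exp f y\<bar> powr p) \<partial>X) \<longlongrightarrow> 0) at_top"
  using pointwise[of p] by (simp add: pointwise_ergodic_thm_def)

text \<open>Norm convergence supplies this: for some T the average differs from its limit by a
  function of finite L^p norm, and the average itself lies in L^p.\<close>

lemma inv_exp_Lp:
  assumes f: "Lp_fun p X f" and p: "p > 1" shows "Lp_fun p X (inv_exp f)"
proof -
  have "\<forall>\<^sub>F T in at_top. (\<integral>\<^sup>+ y. ennreal (\<bar>A T f y - inv_exp f y\<bar> powr p) \<partial>X) < 1"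
    using order_tendstoD(2)[OF pointwise_Lp[OF assms], of 1] by simp
  then have "\<forall>\<^sub>F T in at_top. T > 0 \<and> (\<integral>\<^sup>+ y. ennreal (\<bar>A T f y - inv_exp f y\<bar> powr p) \<partial>X) < 1"
    by (intro eventually_conj eventually_gt_at_top)
  then obtain T where T: "T > 0" "(\<integral>\<^sup>+ y. ennreal (\<bar>A T f y - inv_exp f y\<bar> powr p) \<partial>X) < 1"
    by (metis (mono_tags, lifting) eventually_at_top_linorder order_refl)
  have [measurable]: "A T f \<in> borel_measurable X" using avg_Lp[OF f p T(1)] by (rule Lp_fun_measurable)
  have "Lp_fun p X (\<lambda>y. A T f y - inv_exp f y)"
    unfolding Lp_fun_iff using less_trans[OF T(2), of \<infinity>] by simp
  from Lp_fun_diff[OF avg_Lp[OF f p T(1)] this] show ?thesis using p by simp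
qed

section \<open>Averages of bounded functions and suprema over real parameters\<close>

lemma bounded_set_integrable:
  assumes [measurable]: "f \<in> borel_measurable X" and "\<And>y. y \<in> space X \<Longrightarrow> \<bar>f y\<bar> \<le> c" and x: "x \<in> space X"
    and T: "K \<in> fmeasurable \<mu>"
  shows "set_integrable \<mu> K (\<lambda>h. rep G a h f x)"
  unfolding set_integrable_def
proof (rule Bochner_Integration.integrable_bound)
  show "integrable \<mu> (\<lambda>h. c * indicat_real K h)" using T by (auto simp: fmeasurable_def)
  show "(\<lambda>h. indicat_real K h *\<^sub>R rep G a h f x) \<in> borel_measurable \<mu>"
    using rep_measurable_group[OF assms(1) x] T by auto
  show "AE h in \<mu>. norm (indicat_real K h *\<^sub>R rep G a h f x) \<le> norm (c * indicat_real K h)"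
  proof (rule AE_I2)
    fix h assume "h \<in> space \<mu>"
    then have "\<bar>rep G a h f x\<bar> \<le> c" unfolding rep_def using x by (intro assms action_space inv_in) (auto simp: space_haar)
    then show "norm (indicat_real K h *\<^sub>R rep G a h f x) \<le> norm (c * indicat_real K h)"
      by (auto simp: indicator_def)
  qed
qed

lemma avg_const: "T > 0 \<Longrightarrow> A T (\<lambda>_. c) x = c"
  using measure_E_pos[of T] E_sets[of T] by (simp add: avg_def rep_def set_lebesgue_integral_def)

lemma rep_abs_le:
  assumes "\<And>y. y \<in> space X \<Longrightarrow> \<bar>f y\<bar> \<le> g y" "x \<in> space X" "h \<in> H"
  shows "\<bar>rep G a h f x\<bar> \<le> rep G a h g x"
  using assms by (simp add: rep_def action_space inv_in)

lemma avg_mono_bounded: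
  assumes "\<And>y. y \<in> space X \<Longrightarrow> \<bar>f y\<bar> \<le> g y" "g \<in> borel_measurable X" "\<And>y. y \<in> space X \<Longrightarrow> \<bar>g y\<bar> \<le> c"
    and x: "x \<in> space X" and T: "T > 0"
  shows "\<bar>A T f x\<bar> \<le> A T g x"
  using assms E_subset[OF T]
  by (intro avg_le bounded_set_integrable[where c=c] E_fmeasurable E_sets AE_I2 impI rep_abs_le) auto

lemma avg_bounded:
  assumes "\<And>y. y \<in> space X \<Longrightarrow> \<bar>f y\<bar> \<le> c" and x: "x \<in> space X" and T: "T > 0"
  shows "\<bar>A T f x\<bar> \<le> c"
  using avg_mono_bounded[of f "\<lambda>_. c" "\<bar>c\<bar>" x T] assms by (simp add: avg_const)

text \<open>For bounded f the integral over \<open>E T\<close> is Lipschitz in the set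
  \<open>E T\<close> under the symmetric-difference metric. Parameters that are dense in that metric
  therefore reach every average, without any continuity in T.\<close>

lemma avg_separable:
  assumes I: "I \<subseteq> {0<..}"
  obtains D where "countable D" "D \<subseteq> I" "I \<noteq> {} \<Longrightarrow> D \<noteq> {}"
    "\<And>(f :: _ \<Rightarrow> real) c x s. f \<in> borel_measurable X \<Longrightarrow> \<forall>y\<in>space X. \<bar>f y\<bar> \<le> c \<Longrightarrow> x \<in> space X \<Longrightarrow> s \<in> I \<Longrightarrow>
      \<exists>t. (\<forall>j::nat. t j \<in> D) \<and> (\<lambda>j. A (t j) f x) \<longlonglongrightarrow> A s f x"
proof -
  obtain D where D: "countable D" "D \<subseteq> I"
    "\<And>s e. s \<in> I \<Longrightarrow> e > 0 \<Longrightarrow> \<exists>t\<in>D. measure \<mu> (sym_diff (E s) (E t)) < e"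
    by (rule compact_family_separable[where F=E and I=I]) (use I compact_E in auto)
  show thesis
  proof (rule that[OF D(1,2)])
    show "D \<noteq> {}" if "I \<noteq> {}" using that D(3)[of _ 1] by force
    fix f :: "_ \<Rightarrow> real" and c x s assume f [measurable]: "f \<in> borel_measurable X" and c: "\<forall>y\<in>space X. \<bar>f y\<bar> \<le> c"
      and x: "x \<in> space X" and s: "s \<in> I"
    have "\<exists>t\<in>D. measure \<mu> (sym_diff (E s) (E t)) < 1 / real (Suc j)" for j by (rule D(3)[OF s]) simp
    then obtain t where t: "\<And>j. t j \<in> D" "\<And>j. measure \<mu> (sym_diff (E s) (E (t j))) < 1 / real (Suc j)" by metis
    have pos: "s > 0" "t j > 0" for j using s t(1)[of j] I D(2) by auto
    have d0: "(\<lambda>j. measure \<mu> (sym_diff (E s) (E (t j)))) \<longlonglongrightarrow> 0"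
      by (rule tendsto_sandwich[OF _ _ tendsto_const LIMSEQ_inverse_real_of_nat])
        (use t(2) in \<open>auto intro!: always_eventually less_imp_le simp: inverse_eq_divide\<close>)
    have num: "\<bar>(LINT h:E (t j)|\<mu>. rep G a h \<phi> x) - (LINT h:E s|\<mu>. rep G a h \<phi> x)\<bar>
        \<le> b * measure \<mu> (sym_diff (E s) (E (t j)))"
      if [measurable]: "\<phi> \<in> borel_measurable X" and b: "\<And>y. y \<in> space X \<Longrightarrow> \<bar>\<phi> y\<bar> \<le> b" for \<phi> :: "_ \<Rightarrow> real" and b j
    proof -
      let ?S = "sym_diff (E s) (E (t j))"
      have int: "set_integrable \<mu> (E r) (\<lambda>h. rep G a h \<phi> x)" if "r > 0" for r
        by (rule bounded_set_integrable) (use b x that E_fmeasurable in auto)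
      have S: "?S \<in> fmeasurable \<mu>" using E_fmeasurable pos by (intro fmeasurable.Un fmeasurable.Diff) auto
      have "(LINT h:E (t j)|\<mu>. rep G a h \<phi> x) - (LINT h:E s|\<mu>. rep G a h \<phi> x)
          = (\<integral>h. indicat_real (E (t j)) h *\<^sub>R rep G a h \<phi> x - indicat_real (E s) h *\<^sub>R rep G a h \<phi> x \<partial>\<mu>)"
        unfolding set_lebesgue_integral_def using int[OF pos(1)] int[OF pos(2)[of j]]
        by (subst Bochner_Integration.integral_diff) (auto simp: set_integrable_def)
      also have "norm \<dots> \<le> (\<integral>h. norm (indicat_real (E (t j)) h *\<^sub>R rep G a h \<phi> x - indicat_real (E s) h *\<^sub>R rep G a h \<phi> x) \<partial>\<mu>)"
        by (rule integral_norm_bound)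
      \<comment> \<open>Off the symmetric difference the two integrands agree.\<close>
      also have "\<dots> \<le> (\<integral>h. b * indicat_real ?S h \<partial>\<mu>)"
      proof (rule integral_mono_AE')
        show "integrable \<mu> (\<lambda>h. b * indicat_real ?S h)" using S by (auto simp: fmeasurable_def)
        have rb: "\<bar>rep G a h \<phi> x\<bar> \<le> b" if "h \<in> space \<mu>" for h
          unfolding rep_def using x that by (intro b action_space inv_in) (auto simp: space_haar)
        show "AE h in \<mu>. norm (indicat_real (E (t j)) h *\<^sub>R rep G a h \<phi> x - indicat_real (E s) h *\<^sub>R rep G a h \<phi> x) \<le> b * indicat_real ?S h"
          using rb by (intro AE_I2) (auto simp: indicator_def)
        show "AE h in \<mu>. 0 \<le> b * indicat_real ?S h"
          using order_trans[OF abs_ge_zero rb] by (intro AE_I2) auto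
      qed
      also have "\<dots> = b * measure \<mu> ?S" using S by simp
      finally show ?thesis by simp
    qed
    have lim: "(\<lambda>j. LINT h:E (t j)|\<mu>. rep G a h \<phi> x) \<longlonglongrightarrow> (LINT h:E s|\<mu>. rep G a h \<phi> x)"
      if "\<phi> \<in> borel_measurable X" "\<And>y. y \<in> space X \<Longrightarrow> \<bar>\<phi> y\<bar> \<le> b" for \<phi> :: "_ \<Rightarrow> real" and b
    proof (rule LIM_zero_cancel, rule Lim_null_comparison)
      show "\<forall>\<^sub>F j in sequentially. norm ((LINT h:E (t j)|\<mu>. rep G a h \<phi> x) - (LINT h:E s|\<mu>. rep G a h \<phi> x))
          \<le> b * measure \<mu> (sym_diff (E s) (E (t j)))" using num[of \<phi> b] that by auto
      show "(\<lambda>j. b * measure \<mu> (sym_diff (E s) (E (t j)))) \<longlonglongrightarrow> 0"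
        using tendsto_mult_right_zero[OF d0] by simp
    qed
    \<comment> \<open>The denominators converge for the same reason as the numerators, being
      integrals of the constant 1.\<close>
    have m: "(LINT h:E r|\<mu>. rep G a h (\<lambda>_. 1) x) = measure \<mu> (E r)" if "r > 0" for r
      using E_sets[OF that] by (simp add: rep_def set_lebesgue_integral_def)
    have "(\<lambda>j. measure \<mu> (E (t j))) \<longlonglongrightarrow> measure \<mu> (E s)"
      using lim[of "\<lambda>_. 1" 1] m pos by simp
    then have "(\<lambda>j. A (t j) f x) \<longlonglongrightarrow> A s f x"
      unfolding avg_def using lim[OF f, of c] c measure_E_pos[OF pos(1)] by (intro tendsto_divide) auto
    with t show "\<exists>t. (\<forall>j::nat. t j \<in> D) \<and> (\<lambda>j. A (t j) f x) \<longlonglongrightarrow> A s f x" by blast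
  qed
qed

text \<open>The pointwise supremum of the averages over all real parameters need not be measurable as
  such, and the integral in the maximal inequality is then only a lower integral. Truncated functions
  admit a countable dense set of parameters, and monotone convergence removes the truncation.\<close>
lemma measurable_maximal_function:
  assumes p: "p > 1"
  obtains C :: real where "C \<ge> 0" "\<And>f. Lp_fun p X f \<Longrightarrow> \<exists>N. N \<in> borel_measurable X \<and>
    (\<forall>x\<in>space X. \<forall>T>0. ennreal (\<bar>A T f x\<bar> powr p) \<le> N x) \<and>
    (\<integral>\<^sup>+x. N x \<partial>X) \<le> ennreal C * (\<integral>\<^sup>+x. ennreal (\<bar>f x\<bar> powr p) \<partial>X)"
proof -
  obtain C :: real where C: "C \<ge> 0" "\<And>f. Lp_fun p X f \<Longrightarrow> (\<integral>\<^sup>+ y. (SUP T\<in>{0<..}. ennreal (\<bar>A T f y\<bar> powr p)) \<partial>X)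
        \<le> ennreal C * (\<integral>\<^sup>+ y. ennreal (\<bar>f y\<bar> powr p) \<partial>X)"
    by (rule maximal_constant[OF p]) metis
  obtain D where D: "countable D" "D \<subseteq> {0<..}"
    "\<And>(f :: _ \<Rightarrow> real) c x s. f \<in> borel_measurable X \<Longrightarrow> \<forall>y\<in>space X. \<bar>f y\<bar> \<le> c \<Longrightarrow> x \<in> space X \<Longrightarrow> s \<in> {0<..} \<Longrightarrow>
      \<exists>t. (\<forall>j::nat. t j \<in> D) \<and> (\<lambda>j. A (t j) f x) \<longlonglongrightarrow> A s f x"
    by (rule avg_separable[of "{0<..}"]) auto
  show thesis
  proof (rule that[OF C(1)])
    fix f assume f: "Lp_fun p X f"
    have [measurable]: "f \<in> borel_measurable X" using f by (rule Lp_fun_measurable)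
    \<comment> \<open>The absolute value makes the truncations increase with k, as monotone
      convergence requires.\<close>
    define fk where "fk k y = min \<bar>f y\<bar> (real k)" for k :: nat and y
    have [measurable]: "fk k \<in> borel_measurable X" for k unfolding fk_def by measurable
    have fkb: "\<bar>fk k y\<bar> \<le> real k" for k y unfolding fk_def by auto
    have fk0: "fk k y \<ge> 0" for k y unfolding fk_def by auto
    have fkmono: "fk k y \<le> fk l y" if "k \<le> l" for k l y unfolding fk_def using that by auto
    define Nk where "Nk k x = (SUP T\<in>D. ennreal (\<bar>A T (fk k) x\<bar> powr p))" for k x
    have [measurable]: "Nk k \<in> borel_measurable X" for k
      unfolding Nk_def by (intro borel_measurable_SUP D(1) measurable_compose[OF _ measurable_ennreal] measurable_abs_powr avg_measurable E_sets)
        (use D(2) in auto)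
    define N where "N x = (SUP k. Nk k x)" for x
    have mN: "N \<in> borel_measurable X" unfolding N_def by measurable
    have fkN: "ennreal (\<bar>A T (fk k) x\<bar> powr p) \<le> N x" if x: "x \<in> space X" and T: "T > 0" for k x T
    proof -
      obtain t where t: "\<And>j::nat. t j \<in> D" "(\<lambda>j. A (t j) (fk k) x) \<longlonglongrightarrow> A T (fk k) x"
        using D(3)[of "fk k" "real k" x T] fkb x T by auto
      have "(\<lambda>j. ennreal (\<bar>A (t j) (fk k) x\<bar> powr p)) \<longlonglongrightarrow> ennreal (\<bar>A T (fk k) x\<bar> powr p)"
        using p by (intro tendsto_ennrealI tendsto_powr' tendsto_rabs t(2) tendsto_const) auto
      moreover have "ennreal (\<bar>A (t j) (fk k) x\<bar> powr p) \<le> Nk k x" for j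
        unfolding Nk_def by (intro SUP_upper t(1))
      ultimately have "ennreal (\<bar>A T (fk k) x\<bar> powr p) \<le> Nk k x"
        by (intro LIMSEQ_le_const2) blast+
      also have "\<dots> \<le> N x" unfolding N_def using SUP_upper[of k UNIV "\<lambda>k. Nk k x"] by simp
      finally show ?thesis .
    qed
    have fN: "ennreal (\<bar>A T f x\<bar> powr p) \<le> N x" if x: "x \<in> space X" and T: "T > 0" for x T
    \<comment> \<open>An infinite value bounds everything. A finite value r gives the common bound
      \<open>r powr (1 / p)\<close> for all truncated averages, which passes to f by monotone
      convergence along the orbit.\<close>
    proof (cases "N x = \<infinity>")
      case False
      define r where "r = enn2real (N x)"
      have r: "N x = ennreal r" "r \<ge> 0" using False by (auto simp: r_def less_top)
      have fin: "A T (fk k) x \<le> r powr (1 / p)" for k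
      proof -
        have "\<bar>A T (fk k) x\<bar> powr p \<le> r" using fkN[OF x T, of k] r by simp
        then have "(\<bar>A T (fk k) x\<bar> powr p) powr (1 / p) \<le> r powr (1 / p)" using p by (intro powr_mono2) auto
        then show ?thesis using p by (simp add: powr_powr)
      qed
      have m: "measure \<mu> (E T) > 0" by (rule measure_E_pos[OF T])
      have [measurable]: "(\<lambda>h. rep G a h f x) \<in> borel_measurable \<mu>" "(\<lambda>h. rep G a h (fk k) x) \<in> borel_measurable \<mu>" for k
        using x by (auto intro!: rep_measurable_group)
      note [measurable] = E_sets[OF T]
      have intk: "(\<integral>\<^sup>+h. ennreal (indicat_real (E T) h * rep G a h (fk k) x) \<partial>\<mu>) \<le> ennreal (r powr (1 / p) * measure \<mu> (E T))" for k
      proof -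
        have "set_integrable \<mu> (E T) (\<lambda>h. rep G a h (fk k) x)"
          by (rule bounded_set_integrable[where c="real k"]) (use fkb x E_fmeasurable[OF T] in auto)
        then have "(\<integral>\<^sup>+h. ennreal (indicat_real (E T) h * rep G a h (fk k) x) \<partial>\<mu>)
            = ennreal (LINT h:E T|\<mu>. rep G a h (fk k) x)"
          unfolding set_lebesgue_integral_def set_integrable_def
          by (subst nn_integral_eq_integral) (auto simp: rep_def fk0)
        also have "\<dots> \<le> ennreal (r powr (1 / p) * measure \<mu> (E T))"
          using fin[of k] m by (intro ennreal_leI) (simp add: avg_def field_simps)
        finally show ?thesis .
      qed
      have "(\<integral>\<^sup>+h. ennreal (indicat_real (E T) h * \<bar>rep G a h f x\<bar>) \<partial>\<mu>)
          = (\<integral>\<^sup>+h. (SUP k. ennreal (indicat_real (E T) h * rep G a h (fk k) x)) \<partial>\<mu>)"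
      proof (rule nn_integral_cong)
        fix h
        have "(\<lambda>k. ennreal (indicat_real (E T) h * rep G a h (fk k) x)) \<longlonglongrightarrow> ennreal (indicat_real (E T) h * \<bar>rep G a h f x\<bar>)"
        proof (rule tendsto_eventually)
          obtain n where "\<bar>rep G a h f x\<bar> \<le> real n" using real_arch_simple by blast
          then show "\<forall>\<^sub>F k in sequentially. ennreal (indicat_real (E T) h * rep G a h (fk k) x) = ennreal (indicat_real (E T) h * \<bar>rep G a h f x\<bar>)"
            by (intro eventually_sequentiallyI[of n]) (auto simp: rep_def fk_def min_def)
        qed
        moreover have "incseq (\<lambda>k. ennreal (indicat_real (E T) h * rep G a h (fk k) x))"
          by (auto simp: incseq_def rep_def intro!: ennreal_leI mult_left_mono fkmono)
        ultimately show "ennreal (indicat_real (E T) h * \<bar>rep G a h f x\<bar>) = (SUP k. ennreal (indicat_real (E T) h * rep G a h (fk k) x))"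
          by (metis LIMSEQ_SUP LIMSEQ_unique)
      qed
      also have "\<dots> = (SUP k. \<integral>\<^sup>+h. ennreal (indicat_real (E T) h * rep G a h (fk k) x) \<partial>\<mu>)"
      proof (rule nn_integral_monotone_convergence_SUP)
        show "incseq (\<lambda>k h. ennreal (indicat_real (E T) h * rep G a h (fk k) x))"
          by (auto simp: incseq_def le_fun_def rep_def intro!: ennreal_leI mult_left_mono fkmono)
      qed measurable
      also have "\<dots> \<le> ennreal (r powr (1 / p) * measure \<mu> (E T))" by (rule SUP_least) (rule intk)
      finally have le: "(\<integral>\<^sup>+h. ennreal (indicat_real (E T) h * \<bar>rep G a h f x\<bar>) \<partial>\<mu>) \<le> ennreal (r powr (1 / p) * measure \<mu> (E T))" .
      have "\<bar>LINT h:E T|\<mu>. rep G a h f x\<bar> \<le> r powr (1 / p) * measure \<mu> (E T)"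
      \<comment> \<open>Without integrability the integral is 0 by convention, so the bound holds in
        either case.\<close>
      proof (cases "set_integrable \<mu> (E T) (\<lambda>h. rep G a h f x)")
        case True
        have "ennreal (norm (LINT h:E T|\<mu>. rep G a h f x)) \<le> (\<integral>\<^sup>+h. ennreal (norm (indicat_real (E T) h *\<^sub>R rep G a h f x)) \<partial>\<mu>)"
          using True unfolding set_integrable_def set_lebesgue_integral_def by (rule integral_norm_bound_ennreal)
        also have "\<dots> \<le> ennreal (r powr (1 / p) * measure \<mu> (E T))" using le by (simp add: abs_mult)
        finally show ?thesis by (simp add: ennreal_le_iff)
      next
        case False
        then show ?thesis by (simp add: set_integrable_def set_lebesgue_integral_def not_integrable_integral_eq)
      qed
      then have "\<bar>A T f x\<bar> \<le> r powr (1 / p)" using m by (simp add: avg_def field_simps)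
      then have "\<bar>A T f x\<bar> powr p \<le> (r powr (1 / p)) powr p" using p by (intro powr_mono2) auto
      also have "\<dots> = r" using p r(2) by (simp add: powr_powr)
      finally show ?thesis using r by (simp add: ennreal_leI)
    qed simp
    have "(\<integral>\<^sup>+x. N x \<partial>X) = (\<integral>\<^sup>+x. (SUP k. Nk k x) \<partial>X)" by (simp add: N_def)
    also have "\<dots> = (SUP k. \<integral>\<^sup>+x. Nk k x \<partial>X)"
    proof (rule nn_integral_monotone_convergence_SUP_AE)
      show "AE x in X. Nk k x \<le> Nk (Suc k) x" for k
      proof (rule AE_I2)
        fix x assume x: "x \<in> space X"
        show "Nk k x \<le> Nk (Suc k) x" unfolding Nk_def
        proof (rule SUP_mono)
          fix T assume T: "T \<in> D"
          then have "T > 0" using D(2) by auto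
          then have "\<bar>A T (fk k) x\<bar> \<le> A T (fk (Suc k)) x"
            using x fk0[of k] fkmono[of k "Suc k"] fkb[of "Suc k"]
            by (intro avg_mono_bounded[where c="real (Suc k)"] \<open>fk (Suc k) \<in> borel_measurable X\<close>)
              (auto simp only: abs_of_nonneg le_SucI order_refl)
          then have "\<bar>A T (fk k) x\<bar> powr p \<le> \<bar>A T (fk (Suc k)) x\<bar> powr p" using p by (intro powr_mono2) auto
          then show "\<exists>m\<in>D. ennreal (\<bar>A T (fk k) x\<bar> powr p) \<le> ennreal (\<bar>A m (fk (Suc k)) x\<bar> powr p)"
            using T by (auto intro!: bexI[of _ T] ennreal_leI)
        qed
      qed
    qed measurable
    also have "\<dots> \<le> ennreal C * (\<integral>\<^sup>+x. ennreal (\<bar>f x\<bar> powr p) \<partial>X)"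
    proof (rule SUP_least)
      fix k
      have fkp: "Lp_fun p X (fk k)"
        by (rule Lp_fun_bound[OF f]) (use p in \<open>auto simp: fk_def\<close>)
      \<comment> \<open>The supremum over all T on the right may be non-measurable; monotonicity of
        the nonnegative integral holds nevertheless.\<close>
      have "(\<integral>\<^sup>+x. Nk k x \<partial>X) \<le> (\<integral>\<^sup>+ y. (SUP T\<in>{0<..}. ennreal (\<bar>A T (fk k) y\<bar> powr p)) \<partial>X)"
        unfolding Nk_def by (intro nn_integral_mono SUP_subset_mono D(2) order_refl)
      also have "\<dots> \<le> ennreal C * (\<integral>\<^sup>+ y. ennreal (\<bar>fk k y\<bar> powr p) \<partial>X)" by (rule C(2)[OF fkp])
      also have "\<dots> \<le> ennreal C * (\<integral>\<^sup>+ y. ennreal (\<bar>f y\<bar> powr p) \<partial>X)"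
        using p by (intro mult_left_mono nn_integral_mono ennreal_leI powr_mono2) (auto simp: fk_def)
      finally show "(\<integral>\<^sup>+x. Nk k x \<partial>X) \<le> ennreal C * (\<integral>\<^sup>+ y. ennreal (\<bar>f y\<bar> powr p) \<partial>X)" .
    qed
    finally show "\<exists>N. N \<in> borel_measurable X \<and>
      (\<forall>x\<in>space X. \<forall>T>0. ennreal (\<bar>A T f x\<bar> powr p) \<le> N x) \<and>
      (\<integral>\<^sup>+x. N x \<partial>X) \<le> ennreal C * (\<integral>\<^sup>+x. ennreal (\<bar>f x\<bar> powr p) \<partial>X)"
      using mN fN by blast
  qed
qed

text \<open>The supremum of the deviation over late T tends to 0 almost everywhere by the pointwise
  theorem and never exceeds the bound c plus the modulus of the limit, so its integral tends to
  0.\<close>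

lemma bounded_tail_dominated:
  assumes [measurable]: "f \<in> borel_measurable X" and c: "\<And>y. y \<in> space X \<Longrightarrow> \<bar>f y\<bar> \<le> c" and p: "p > 1" and e: "e > 0"
  shows "\<exists>g T0. T0 > 0 \<and> Lp_fun p X g \<and> (\<integral>x. g x \<partial>X) \<le> e \<and>
    (\<forall>x\<in>space X. \<forall>T\<ge>T0. \<bar>A T f x - inv_exp f x\<bar> \<le> g x)"
proof -
  have fp: "Lp_fun p X f"
    by (rule Lp_fun_bound[OF X.Lp_fun_const[of p c]]) (use c p in \<open>auto intro!: AE_I2 intro: order_trans[OF _ abs_ge_self]\<close>)
  define h where "h = inv_exp f"
  have hp: "Lp_fun p X h" unfolding h_def by (rule inv_exp_Lp[OF fp p])
  have [measurable]: "h \<in> borel_measurable X" using hp by (rule Lp_fun_measurable)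
  \<comment> \<open>Starting at n + 1 keeps all parameters positive, also for n = 0. Countability of
    D makes the supremum measurable, and nonemptiness makes it a genuine real supremum.\<close>
  have "\<exists>D. countable D \<and> D \<subseteq> {real n + 1..} \<and> D \<noteq> {} \<and>
    (\<forall>x\<in>space X. \<forall>s\<ge>real n + 1. \<exists>t. (\<forall>j::nat. t j \<in> D) \<and> (\<lambda>j. A (t j) f x) \<longlonglongrightarrow> A s f x)" for n
  proof -
    have sub: "{real n + 1..} \<subseteq> {0<..}" by auto
    have c': "\<forall>y\<in>space X. \<bar>f y\<bar> \<le> c" using c by blast
    show ?thesis
      by (rule avg_separable[OF sub], rule_tac x=D in exI, intro conjI ballI allI impI)
        (use assms(1) c' in auto)
  qed
  then obtain D where D: "\<And>n. countable (D n)" "\<And>n. D n \<subseteq> {real n + 1..}" "\<And>n. D n \<noteq> {}"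
    "\<And>n x s. x \<in> space X \<Longrightarrow> s \<ge> real n + 1 \<Longrightarrow> \<exists>t. (\<forall>j::nat. t j \<in> D n) \<and> (\<lambda>j. A (t j) f x) \<longlonglongrightarrow> A s f x"
    by metis
  have Dpos: "T > 0" if "T \<in> D n" for T n using D(2)[of n] that by auto
  define g where "g n x = (SUP T\<in>D n. \<bar>A T f x - h x\<bar>)" for n x
  have bd: "\<bar>A T f x - h x\<bar> \<le> c + \<bar>h x\<bar>" if "x \<in> space X" "T \<in> D n" for x T n
    using avg_bounded[of f c x T] c that Dpos by fastforce
  have bdd: "bdd_above ((\<lambda>T. \<bar>A T f x - h x\<bar>) ` D n)" if "x \<in> space X" for x n
    using bd[OF that] by (intro bdd_aboveI2)
  have gm [measurable]: "g n \<in> borel_measurable X" for n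
    unfolding g_def
    by (rule borel_measurable_cSUP[OF D(1) _ bdd])
      (use Dpos E_sets in \<open>auto intro!: borel_measurable_abs borel_measurable_diff avg_measurable\<close>)
  have gle: "g n x \<le> c + \<bar>h x\<bar>" and g0: "g n x \<ge> 0" if x: "x \<in> space X" for n x
  proof -
    show "g n x \<le> c + \<bar>h x\<bar>" unfolding g_def using bd[OF x] D(3) by (intro cSUP_least)
    obtain T where "T \<in> D n" using D(3) by blast
    then have "\<bar>A T f x - h x\<bar> \<le> g n x" unfolding g_def by (intro cSUP_upper bdd x)
    then show "g n x \<ge> 0" by linarith
  qed
  have gp: "Lp_fun p X (g n)" for n
    by (rule Lp_fun_bound[OF Lp_fun_add[OF X.Lp_fun_const[of p c] Lp_fun_abs[OF hp]]])
      (use gle g0 p in \<open>auto intro!: AE_I2 intro: order_trans[OF _ abs_ge_self]\<close>)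
  have "(\<lambda>n. \<integral>x. g n x \<partial>X) \<longlonglongrightarrow> (\<integral>x. 0 \<partial>X)"
  proof (rule integral_dominated_convergence[where w="\<lambda>x. c + \<bar>h x\<bar>"])
    show "integrable X (\<lambda>x. c + \<bar>h x\<bar>)" using X.Lp_fun_integrable[OF hp p] by auto
    show "AE x in X. norm (g n x) \<le> c + \<bar>h x\<bar>" for n using gle g0 by (intro AE_I2) auto
    show "AE x in X. (\<lambda>n. g n x) \<longlonglongrightarrow> 0"
      using AE_space pointwise_AE[OF fp p]
    proof eventually_elim
      case (elim x)
      show ?case
      proof (rule LIMSEQ_I)
        fix r :: real assume r: "r > 0"
        have "\<forall>\<^sub>F T in at_top. dist (A T f x) (h x) < r / 2"
          using elim(2) r unfolding h_def by (intro tendstoD) auto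
        then obtain T0 where T0: "\<And>T. T \<ge> T0 \<Longrightarrow> \<bar>A T f x - h x\<bar> < r / 2"
          unfolding eventually_at_top_linorder dist_real_def by blast
        obtain n0 where n0: "T0 \<le> real n0" using real_arch_simple by blast
        have "norm (g n x - 0) < r" if "n \<ge> n0" for n
        proof -
          have "g n x \<le> r / 2" unfolding g_def
          proof (rule cSUP_least[OF D(3)])
            fix T assume "T \<in> D n"
            then have "T \<ge> T0" using D(2)[of n] n0 that by fastforce
            then show "\<bar>A T f x - h x\<bar> \<le> r / 2" using T0 by (simp add: less_imp_le)
          qed
          then show ?thesis using g0[OF elim(1), of n] r by auto
        qed
        then show "\<exists>no. \<forall>n\<ge>no. norm (g n x - 0) < r" by blast
      qed
    qed
  qed auto
  then have "\<forall>\<^sub>F n in sequentially. (\<integral>x. g n x \<partial>X) < e" by (rule order_tendstoD) (use e in simp)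
  then obtain n where n: "(\<integral>x. g n x \<partial>X) < e" by (auto simp: eventually_sequentially)
  have "\<bar>A T f x - inv_exp f x\<bar> \<le> g n x" if x: "x \<in> space X" and T: "T \<ge> real n + 1" for x T
  proof -
    \<comment> \<open>Limits along \<open>D n\<close> carry the bound from the countable set to
      every real T in the tail.\<close>
    obtain t where t: "\<And>j::nat. t j \<in> D n" "(\<lambda>j. A (t j) f x) \<longlonglongrightarrow> A T f x" using D(4)[OF x T] by blast
    have "(\<lambda>j. \<bar>A (t j) f x - h x\<bar>) \<longlonglongrightarrow> \<bar>A T f x - h x\<bar>" by (intro tendsto_intros t)
    moreover have "\<bar>A (t j) f x - h x\<bar> \<le> g n x" for j unfolding g_def by (intro cSUP_upper bdd x t)
    ultimately have "\<bar>A T f x - h x\<bar> \<le> g n x" by (intro LIMSEQ_le_const2) auto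
    then show ?thesis by (simp add: h_def)
  qed
  then show ?thesis using n gp by (intro exI[of _ "g n"] exI[of _ "real n + 1"]) auto
qed

section \<open>Majorants with small integral for unbounded functions\<close>

lemma inv_exp_L1_contraction:
  assumes "integrable X f"
  shows "(\<integral>x. \<bar>inv_exp f x\<bar> \<partial>X) \<le> (\<integral>x. \<bar>f x\<bar> \<partial>X)"
proof -
  have "AE x in X. inv_exp (\<lambda>x. - 1 * \<bar>f x\<bar>) x = -1 * inv_exp (\<lambda>x. \<bar>f x\<bar>) x"
    using assms by (intro I.real_cond_exp_cmult) auto
  moreover have "AE x in X. inv_exp f x \<le> inv_exp (\<lambda>x. \<bar>f x\<bar>) x"
    using assms by (intro I.real_cond_exp_mono) auto
  moreover have "AE x in X. inv_exp (\<lambda>x. - 1 * \<bar>f x\<bar>) x \<le> inv_exp f x"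
    using assms by (intro I.real_cond_exp_mono) auto
  ultimately have "AE x in X. \<bar>inv_exp f x\<bar> \<le> inv_exp (\<lambda>x. \<bar>f x\<bar>) x"
    by eventually_elim auto
  then have "(\<integral>x. \<bar>inv_exp f x\<bar> \<partial>X) \<le> (\<integral>x. inv_exp (\<lambda>x. \<bar>f x\<bar>) x \<partial>X)"
    using assms by (intro integral_mono_AE integrable_abs I.real_cond_exp_int) auto
  also have "\<dots> = (\<integral>x. \<bar>f x\<bar> \<partial>X)" using assms by (intro I.real_cond_exp_int) auto
  finally show ?thesis .
qed

text \<open>Turns an L^p bound into smallness of an integral. Where M > s one has M = M^(1-p) M^p <=
  s^(1-p) M^p, so M <= s + s^(1-p) M^p everywhere; the choice of s settles the first summand and the
  choice of d the second.\<close>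

lemma maximal_dominated:
  assumes p: "p > 1" and e: "e > 0"
  shows "\<exists>d>0. \<forall>f. Lp_fun p X f \<longrightarrow> (\<integral>x. \<bar>f x\<bar> powr p \<partial>X) \<le> d \<longrightarrow>
    (\<exists>M. Lp_fun p X M \<and> (\<integral>x. M x \<partial>X) \<le> e \<and> (AE x in X. \<forall>T>0. \<bar>A T f x\<bar> \<le> M x))"
proof -
  obtain C :: real where C: "C \<ge> 0" "\<And>f. Lp_fun p X f \<Longrightarrow> \<exists>N. N \<in> borel_measurable X \<and>
    (\<forall>x\<in>space X. \<forall>T>0. ennreal (\<bar>A T f x\<bar> powr p) \<le> N x) \<and>
    (\<integral>\<^sup>+x. N x \<partial>X) \<le> ennreal C * (\<integral>\<^sup>+x. ennreal (\<bar>f x\<bar> powr p) \<partial>X)"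
    by (rule measurable_maximal_function[OF p]) metis
  define s where "s = e / 2"
  have s: "s > 0" using e by (simp add: s_def)
  \<comment> \<open>The integral of M^p will be at most C d, so the second summand contributes s C /
    (C + 1), which is at most s. The added 1 avoids division by 0 when C = 0.\<close>
  define d where "d = s / ((C + 1) * s powr (1 - p))"
  have d: "d > 0" using s C(1) by (simp add: d_def)
  show ?thesis
  proof (intro exI[of _ d] conjI d allI impI)
    fix f assume f: "Lp_fun p X f" and fd: "(\<integral>x. \<bar>f x\<bar> powr p \<partial>X) \<le> d"
    obtain N where N [measurable]: "N \<in> borel_measurable X"
      and NA: "\<And>x T. x \<in> space X \<Longrightarrow> T > 0 \<Longrightarrow> ennreal (\<bar>A T f x\<bar> powr p) \<le> N x"
      and NC: "(\<integral>\<^sup>+x. N x \<partial>X) \<le> ennreal C * (\<integral>\<^sup>+x. ennreal (\<bar>f x\<bar> powr p) \<partial>X)"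
      using C(2)[OF f] by blast
    have "(\<integral>\<^sup>+x. ennreal (\<bar>f x\<bar> powr p) \<partial>X) = ennreal (\<integral>x. \<bar>f x\<bar> powr p \<partial>X)"
      using f by (intro nn_integral_eq_integral) (auto simp: Lp_fun_def)
    then have Nd: "(\<integral>\<^sup>+x. N x \<partial>X) \<le> ennreal (C * d)"
      using NC fd C(1) by (auto simp flip: ennreal_mult' intro: order_trans[OF _ ennreal_leI] mult_left_mono)
    then have fin: "AE x in X. N x \<noteq> \<infinity>"
      by (intro nn_integral_PInf_AE) (auto simp: top_unique)
    \<comment> \<open>Where N is infinite \<open>enn2real\<close> returns 0, but this happens only
      on a null set.\<close>
    define r where "r x = enn2real (N x)" for x
    have [measurable]: "r \<in> borel_measurable X" unfolding r_def by measurable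
    have Nr: "AE x in X. N x = ennreal (r x)" using fin by eventually_elim (simp add: r_def less_top)
    have r0: "r x \<ge> 0" for x by (simp add: r_def)
    have rint: "(\<integral>\<^sup>+x. ennreal (r x) \<partial>X) \<le> ennreal (C * d)"
      using Nd nn_integral_cong_AE[OF Nr] by simp
    have ri: "integrable X r" unfolding integrable_iff_bounded
      using rint r0 by (auto intro: le_less_trans)
    have rI: "(\<integral>x. r x \<partial>X) \<le> C * d"
      using rint r0 d C(1) nn_integral_eq_integral[OF ri] by (simp add: ennreal_le_iff)
    define M where "M x = r x powr (1 / p)" for x
    have [measurable]: "M \<in> borel_measurable X" unfolding M_def by measurable
    have M0: "M x \<ge> 0" for x by (simp add: M_def)
    have Mp: "M x powr p = r x" for x using r0[of x] p by (simp add: M_def powr_powr)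
    have Lp: "Lp_fun p X M" using ri M0 by (simp add: Lp_fun_def Mp)
    have Mle: "M x \<le> s + s powr (1 - p) * r x" for x
    proof (cases "M x \<le> s")
      case True
      then show ?thesis using r0[of x] s by (simp add: add_increasing2)
    next
      case False
      then have Ms: "M x > s" by simp
      have "M x = M x powr (1 - p) * M x powr p" using Ms s by (simp flip: powr_add)
      also have "\<dots> \<le> s powr (1 - p) * M x powr p"
        using Ms s p by (intro mult_right_mono powr_mono2') auto
      finally show ?thesis using s by (simp add: Mp)
    qed
    have "(\<integral>x. M x \<partial>X) \<le> (\<integral>x. s + s powr (1 - p) * r x \<partial>X)"
      using Mle ri X.Lp_fun_integrable[OF Lp p] by (intro integral_mono) auto
    also have "\<dots> = s + s powr (1 - p) * (\<integral>x. r x \<partial>X)" using ri by (simp add: X.prob_space)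
    also have "\<dots> \<le> s + s powr (1 - p) * (C * d)" using rI by (intro add_left_mono mult_left_mono) auto
    also have "s powr (1 - p) * (C * d) \<le> s"
    proof -
      have "s powr (1 - p) * (C * d) = s * (C / (C + 1))" using s by (simp add: d_def)
      also have "\<dots> \<le> s * 1" using s C(1) by (intro mult_left_mono) (auto simp: field_simps)
      finally show ?thesis by simp
    qed
    finally have Me: "(\<integral>x. M x \<partial>X) \<le> e" by (simp add: s_def)
    have "AE x in X. \<forall>T>0. \<bar>A T f x\<bar> \<le> M x"
      using Nr AE_space
    proof eventually_elim
      case (elim x)
      show ?case
      proof (intro allI impI)
        fix T :: real assume "T > 0"
        then have "\<bar>A T f x\<bar> powr p \<le> r x" using NA[OF elim(2), of T] elim(1) r0[of x] by simp
        then have "(\<bar>A T f x\<bar> powr p) powr (1 / p) \<le> r x powr (1 / p)" using p by (intro powr_mono2) auto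
        then show "\<bar>A T f x\<bar> \<le> M x" using p by (simp add: M_def powr_powr)
      qed
    qed
    with Lp Me show "\<exists>M. Lp_fun p X M \<and> (\<integral>x. M x \<partial>X) \<le> e \<and> (AE x in X. \<forall>T>0. \<bar>A T f x\<bar> \<le> M x)"
      by blast
  qed
qed

lemma avg_diff:
  assumes "set_integrable \<mu> (E T) (\<lambda>h. rep G a h f x)" "set_integrable \<mu> (E T) (\<lambda>h. rep G a h g x)"
  shows "A T (\<lambda>y. f y - g y) x = A T f x - A T g x"
  using set_integral_diff(2)[OF assms] by (simp add: avg_def rep_def diff_divide_distrib)

text \<open>Writing E for the conditional expectation and fn for a truncation, |A f - E f| <= |A fn
  - E fn| + |A (f - fn)| + |E fn - E f|. Majorants for the three terms come from the bounded case,
  the maximal inequality and the L^1 contraction, each with integral at most e / 3.\<close>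

lemma tail_dominated:
  assumes f: "Lp_fun p X f" and p: "p > 1" and e: "e > 0"
  shows "\<exists>g T0. T0 > 0 \<and> Lp_fun p X g \<and> (\<integral>x. g x \<partial>X) \<le> e \<and>
    (AE x in X. \<forall>T\<ge>T0. \<bar>A T f x - inv_exp f x\<bar> \<le> g x)"
proof -
  have e3: "e / 3 > 0" using e by simp
  have [measurable]: "f \<in> borel_measurable X" using f by (rule Lp_fun_measurable)
  have fi: "integrable X f" by (rule X.Lp_fun_integrable[OF f p])
  obtain d where d: "d > 0" "\<forall>f. Lp_fun p X f \<longrightarrow> (\<integral>x. \<bar>f x\<bar> powr p \<partial>X) \<le> d \<longrightarrow>
    (\<exists>M. Lp_fun p X M \<and> (\<integral>x. M x \<partial>X) \<le> e / 3 \<and> (AE x in X. \<forall>T>0. \<bar>A T f x\<bar> \<le> M x))"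
    using maximal_dominated[OF p e3] by (elim exE conjE)
  define fn where "fn n x = max (- real n) (min (real n) (f x))" for n x
  have [measurable]: "fn n \<in> borel_measurable X" for n unfolding fn_def by measurable
  have "(\<lambda>n. \<integral>x. \<bar>f x - fn n x\<bar> powr p \<partial>X) \<longlonglongrightarrow> 0"
    unfolding fn_def using f p by (intro Lp_truncation_tendsto) (auto simp: Lp_fun_def)
  then have ev1: "\<forall>\<^sub>F n in sequentially. (\<integral>x. \<bar>f x - fn n x\<bar> powr p \<partial>X) < d"
    by (rule order_tendstoD) (rule d)
  have "(\<lambda>n. \<integral>x. \<bar>f x - fn n x\<bar> powr 1 \<partial>X) \<longlonglongrightarrow> 0"
    unfolding fn_def using fi by (intro Lp_truncation_tendsto) auto
  then have ev2: "\<forall>\<^sub>F n in sequentially. (\<integral>x. \<bar>f x - fn n x\<bar> powr 1 \<partial>X) < e / 3"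
    by (rule order_tendstoD) (rule e3)
  \<comment> \<open>One n serves twice: smallness in L^p feeds the maximal inequality, smallness in
    L^1 the conditional expectation.\<close>
  obtain n where n: "(\<integral>x. \<bar>f x - fn n x\<bar> powr p \<partial>X) < d" "(\<integral>x. \<bar>f x - fn n x\<bar> \<partial>X) < e / 3"
    using eventually_conj[OF ev1 ev2] by (auto simp: eventually_sequentially)
  have fnb: "\<bar>fn n x\<bar> \<le> real n" for x by (auto simp: fn_def)
  have fnLp: "Lp_fun p X (fn n)"
    by (rule Lp_fun_bound[OF f]) (use p in \<open>auto simp: fn_def intro!: AE_I2\<close>)
  have fnI: "integrable X (fn n)" by (rule X.Lp_fun_integrable[OF fnLp p])
  have wLp: "Lp_fun p X (\<lambda>x. f x - fn n x)" using Lp_fun_diff[OF f fnLp] p by simp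
  obtain g1 T0 where g1: "T0 > 0" "Lp_fun p X g1" "(\<integral>x. g1 x \<partial>X) \<le> e / 3"
    "\<And>x T. x \<in> space X \<Longrightarrow> T \<ge> T0 \<Longrightarrow> \<bar>A T (fn n) x - inv_exp (fn n) x\<bar> \<le> g1 x"
    using bounded_tail_dominated[of "fn n" "real n" p "e / 3"] fnb p e3 by auto
  obtain M where M: "Lp_fun p X M" "(\<integral>x. M x \<partial>X) \<le> e / 3"
    "AE x in X. \<forall>T>0. \<bar>A T (\<lambda>x. f x - fn n x) x\<bar> \<le> M x"
    using d(2)[rule_format, OF wLp] n(1) by auto
  define k where "k x = \<bar>inv_exp (fn n) x - inv_exp f x\<bar>" for x
  have kLp: "Lp_fun p X k" unfolding k_def
    using inv_exp_Lp[OF f p] inv_exp_Lp[OF fnLp p] p by (intro Lp_fun_abs Lp_fun_diff) auto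
  have "(\<integral>x. k x \<partial>X) = (\<integral>x. \<bar>inv_exp (\<lambda>x. fn n x - f x) x\<bar> \<partial>X)"
  proof (rule integral_cong_AE)
    show "AE x in X. k x = \<bar>inv_exp (\<lambda>x. fn n x - f x) x\<bar>"
      using I.real_cond_exp_diff[OF fnI fi] by eventually_elim (simp add: k_def)
  qed (auto simp: k_def[abs_def])
  also have "\<dots> \<le> (\<integral>x. \<bar>fn n x - f x\<bar> \<partial>X)" using fnI fi by (intro inv_exp_L1_contraction) auto
  also have "\<dots> = (\<integral>x. \<bar>f x - fn n x\<bar> \<partial>X)" by (simp add: abs_minus_commute)
  finally have kI: "(\<integral>x. k x \<partial>X) \<le> e / 3" using n(2) by simp
  define g where "g x = g1 x + M x + k x" for x
  have "Lp_fun p X g" unfolding g_def using g1 M kLp p by (intro Lp_fun_add) auto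
  moreover have "(\<integral>x. g x \<partial>X) \<le> e"
  proof -
    have "integrable X g1" "integrable X M" "integrable X k" using g1 M kLp p by (auto intro: X.Lp_fun_integrable)
    then have "(\<integral>x. g x \<partial>X) = (\<integral>x. g1 x \<partial>X) + (\<integral>x. M x \<partial>X) + (\<integral>x. k x \<partial>X)" by (simp add: g_def)
    then show ?thesis using g1 M kI by simp
  qed
  moreover have "AE x in X. \<forall>T\<ge>T0. \<bar>A T f x - inv_exp f x\<bar> \<le> g x"
    \<comment> \<open>Splitting the average of a difference needs integrability of both functions
      along the orbit, which holds off one null set for all compact sets and hence for all
      T.\<close>
    using AE_space M(3) AE_set_integrable_rep[OF fi] AE_set_integrable_rep[OF fnI]
  proof eventually_elim
    case (elim x)
    show ?case
    proof (intro allI impI)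
      fix T assume T: "T \<ge> T0"
      then have T': "T > 0" using g1(1) by simp
      have "A T (\<lambda>x. f x - fn n x) x = A T f x - A T (fn n) x"
        using elim(3,4) compact_E[OF T'] by (intro avg_diff) auto
      moreover have "\<bar>A T (\<lambda>x. f x - fn n x) x\<bar> \<le> M x" using elim(2) T' by simp
      moreover have "\<bar>A T (fn n) x - inv_exp (fn n) x\<bar> \<le> g1 x" by (rule g1(4)[OF elim(1) T])
      ultimately show "\<bar>A T f x - inv_exp f x\<bar> \<le> g x" unfolding g_def k_def by linarith
    qed
  qed
  ultimately show ?thesis using g1(1) by blast
qed

end

section \<open>Averages over a product of subgroups\<close>

locale product_averages =
  U: ergodic_averages G \<tau> U mU X a E + V: ergodic_averages G \<tau> V mV X a F
  for G :: "('g, 'b) monoid_scheme" and \<tau> U mU and X :: "'x measure" and a E V mV F +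
  assumes normal: "normal V G"
    and product: "\<And>g. g \<in> carrier G \<Longrightarrow> \<exists>u\<in>U. \<exists>v\<in>V. g = u \<otimes>\<^bsub>G\<^esub> v"
    and act: "mp_action G \<tau> (carrier G) X a"
    and erg: "ergodic_action G (carrier G) X a"
begin

section \<open>Strict invariance and the zero-one law\<close>

lemma U_carrier: "u \<in> U \<Longrightarrow> u \<in> carrier G"
  using U.subgroup subgroup.mem_carrier by fastforce

lemma V_carrier: "v \<in> V \<Longrightarrow> v \<in> carrier G"
  using V.subgroup subgroup.mem_carrier by fastforce

lemma act_mult: "g \<in> carrier G \<Longrightarrow> h \<in> carrier G \<Longrightarrow> x \<in> space X \<Longrightarrow> a (g \<otimes>\<^bsub>G\<^esub> h) x = a g (a h x)"
  using act by (auto simp: mp_action_def)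

text \<open>inv u v = (inv u v u) inv u, and normality puts the conjugate into
  \<open>V\<close>.\<close>

lemma act_inv_normal:
  assumes "u \<in> U" "v \<in> V" "x \<in> space X"
  obtains w where "w \<in> V" "a (inv\<^bsub>G\<^esub> u) (a v x) = a w (a (inv\<^bsub>G\<^esub> u) x)"
proof
  have [simp]: "u \<in> carrier G" "v \<in> carrier G" using assms U_carrier V_carrier by auto
  show w: "inv\<^bsub>G\<^esub> u \<otimes>\<^bsub>G\<^esub> v \<otimes>\<^bsub>G\<^esub> u \<in> V"
    using normal.inv_op_closed1[OF normal] assms by simp
  have "a (inv\<^bsub>G\<^esub> u) (a v x) = a (inv\<^bsub>G\<^esub> u \<otimes>\<^bsub>G\<^esub> v) x" using assms(3) by (simp add: act_mult)
  also have "inv\<^bsub>G\<^esub> u \<otimes>\<^bsub>G\<^esub> v = (inv\<^bsub>G\<^esub> u \<otimes>\<^bsub>G\<^esub> v \<otimes>\<^bsub>G\<^esub> u) \<otimes>\<^bsub>G\<^esub> inv\<^bsub>G\<^esub> u"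
    by (simp add: U.m_assoc)
  also have "a \<dots> x = a (inv\<^bsub>G\<^esub> u \<otimes>\<^bsub>G\<^esub> v \<otimes>\<^bsub>G\<^esub> u) (a (inv\<^bsub>G\<^esub> u) x)"
    using assms(3) by (intro act_mult) auto
  finally show "a (inv\<^bsub>G\<^esub> u) (a v x) = a (inv\<^bsub>G\<^esub> u \<otimes>\<^bsub>G\<^esub> v \<otimes>\<^bsub>G\<^esub> u) (a (inv\<^bsub>G\<^esub> u) x)" .
qed

text \<open>The integrands at \<open>a v x\<close> and at x coincide for every u in
  \<open>U\<close>, so the averages agree at every point, whether or not the integrals
  converge.\<close>

lemma U_average_V_invariant:
  assumes h: "\<And>v x. v \<in> V \<Longrightarrow> x \<in> space X \<Longrightarrow> h (a v x) = h x" and "v \<in> V" "x \<in> space X" "T > 0"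
  shows "U.A T h (a v x) = U.A T h x"
proof -
  have "rep G a u h (a v x) = rep G a u h x" if u: "u \<in> U" for u
  proof -
    obtain w where w: "w \<in> V" "a (inv\<^bsub>G\<^esub> u) (a v x) = a w (a (inv\<^bsub>G\<^esub> u) x)"
      using act_inv_normal[OF u assms(2,3)] .
    then show ?thesis using h[OF w(1) U.action_space[OF U.inv_in[OF u] assms(3)]] by (simp add: rep_def)
  qed
  then have "(LINT u:E T|mU. rep G a u h (a v x)) = (LINT u:E T|mU. rep G a u h x)"
    using U.E_subset[OF \<open>T > 0\<close>] U.E_sets[OF \<open>T > 0\<close>] by (intro set_lebesgue_integral_cong) auto
  then show ?thesis by (simp add: avg_def)
qed

text \<open>Averaging the strictly \<open>V\<close>-invariant set over \<open>U\<close> makes it strictly invariant under all of \<open>G\<close>;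
  using \<open>inv u\<close> in this average means that only left invariance of Haar null sets is needed.\<close>
lemma zero_one:
  assumes A [measurable]: "A \<in> sets X" and AV: "\<And>v x. v \<in> V \<Longrightarrow> x \<in> space X \<Longrightarrow> a v x \<in> A \<longleftrightarrow> x \<in> A"
    and BU: "\<And>u x. u \<in> U \<Longrightarrow> x \<in> space X \<Longrightarrow> a u x \<in> B \<longleftrightarrow> x \<in> B"
    and AB: "AE x in X. x \<in> A \<longleftrightarrow> x \<in> B"
  shows "measure X A = 0 \<or> measure X A = 1"
proof -
  \<comment> \<open>A point is placed in \<open>A'\<close> if its \<open>U\<close>-orbit lies in A
    for almost every u; the orbit condition no longer depends on where on the orbit one
    starts.\<close>
  define Z where "Z x = {u \<in> U. a (inv\<^bsub>G\<^esub> u) x \<notin> A}" for x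
  define A' where "A' = {x \<in> space X. emeasure mU (Z x) = 0}"
  have [measurable]: "(\<lambda>(u, x). a (inv\<^bsub>G\<^esub> u) x) \<in> measurable (mU \<Otimes>\<^sub>M X) X" by (rule U.inv_action_measurable)
  have Q: "{z \<in> space (X \<Otimes>\<^sub>M mU). (\<lambda>(u, x). a (inv\<^bsub>G\<^esub> u) x) (snd z, fst z) \<notin> A} \<in> sets (X \<Otimes>\<^sub>M mU)"
    by measurable
  have ZQ: "Z x = Pair x -` {z \<in> space (X \<Otimes>\<^sub>M mU). (\<lambda>(u, x). a (inv\<^bsub>G\<^esub> u) x) (snd z, fst z) \<notin> A}" if "x \<in> space X" for x
    using that by (auto simp: Z_def space_pair_measure U.space_haar)
  have Zs: "Z x \<in> sets mU" if "x \<in> space X" for x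
    unfolding ZQ[OF that] by (rule sets_Pair1[OF Q])
  have "(\<lambda>x. emeasure mU (Pair x -` {z \<in> space (X \<Otimes>\<^sub>M mU). (\<lambda>(u, x). a (inv\<^bsub>G\<^esub> u) x) (snd z, fst z) \<notin> A})) \<in> borel_measurable X"
    by (rule U.\<mu>.measurable_emeasure_Pair[OF Q])
  then have "(\<lambda>x. emeasure mU (Z x)) \<in> borel_measurable X"
    by (rule measurable_cong[THEN iffD1, rotated]) (simp add: ZQ)
  then have A'm: "A' \<in> sets X" unfolding A'_def by measurable
  have invU: "a u0 x \<in> A' \<longleftrightarrow> x \<in> A'" if u0: "u0 \<in> U" and x: "x \<in> space X" for u0 x
  proof -
    have c0: "u0 \<in> carrier G" using U_carrier[OF u0] .
    have eq: "a (inv\<^bsub>G\<^esub> (u0 \<otimes>\<^bsub>G\<^esub> w)) (a u0 x) = a (inv\<^bsub>G\<^esub> w) x" if w: "w \<in> U" for w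
    proof -
      have cw: "w \<in> carrier G" using U_carrier[OF w] .
      have "a (inv\<^bsub>G\<^esub> (u0 \<otimes>\<^bsub>G\<^esub> w)) (a u0 x) = a (inv\<^bsub>G\<^esub> (u0 \<otimes>\<^bsub>G\<^esub> w) \<otimes>\<^bsub>G\<^esub> u0) x"
        using c0 cw x by (simp add: act_mult)
      also have "inv\<^bsub>G\<^esub> (u0 \<otimes>\<^bsub>G\<^esub> w) \<otimes>\<^bsub>G\<^esub> u0 = inv\<^bsub>G\<^esub> w"
        using c0 cw by (simp add: U.inv_mult_group U.m_assoc)
      finally show ?thesis .
    qed
    \<comment> \<open>inv (u0 w) u0 = inv w, so moving x by u0 translates the exceptional set by u0
      on the left and keeps its Haar measure.\<close>
    have "Z (a u0 x) = (\<lambda>w. u0 \<otimes>\<^bsub>G\<^esub> w) ` Z x"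
    proof
      show "(\<lambda>w. u0 \<otimes>\<^bsub>G\<^esub> w) ` Z x \<subseteq> Z (a u0 x)"
        using eq u0 subgroup.m_closed[OF U.subgroup] by (auto simp: Z_def)
      show "Z (a u0 x) \<subseteq> (\<lambda>w. u0 \<otimes>\<^bsub>G\<^esub> w) ` Z x"
      proof
        fix u assume u: "u \<in> Z (a u0 x)"
        then have uU: "u \<in> U" by (simp add: Z_def)
        define w where "w = inv\<^bsub>G\<^esub> u0 \<otimes>\<^bsub>G\<^esub> u"
        have wU: "w \<in> U" unfolding w_def using uU u0 by (simp add: subgroup.m_closed[OF U.subgroup] U.inv_in)
        have uw: "u = u0 \<otimes>\<^bsub>G\<^esub> w" unfolding w_def using c0 U_carrier[OF uU] by (simp flip: U.m_assoc)
        then have "w \<in> Z x" using u eq[OF wU] wU by (simp add: Z_def)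
        then show "u \<in> (\<lambda>w. u0 \<otimes>\<^bsub>G\<^esub> w) ` Z x" using uw by blast
      qed
    qed
    then have "emeasure mU (Z (a u0 x)) = emeasure mU (Z x)"
      using U.haar u0 Zs[OF x] by (simp add: left_haar_def)
    then show ?thesis using x U.action_space[OF u0 x] by (simp add: A'_def)
  qed
  have invV: "a v x \<in> A' \<longleftrightarrow> x \<in> A'" if v: "v \<in> V" and x: "x \<in> space X" for v x
  proof -
    \<comment> \<open>The conjugate w varies with u, which is harmless because A is invariant under
      every element of \<open>V\<close>.\<close>
    have "a (inv\<^bsub>G\<^esub> u) (a v x) \<in> A \<longleftrightarrow> a (inv\<^bsub>G\<^esub> u) x \<in> A" if u: "u \<in> U" for u
    proof -
      obtain w where w: "w \<in> V" "a (inv\<^bsub>G\<^esub> u) (a v x) = a w (a (inv\<^bsub>G\<^esub> u) x)"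
        using act_inv_normal[OF u v x] .
      then show ?thesis using AV[OF w(1) U.action_space[OF U.inv_in[OF u] x]] by simp
    qed
    then have "Z (a v x) = Z x" by (auto simp: Z_def)
    then show ?thesis using x V.action_space[OF v x] by (simp add: A'_def)
  qed
  have "a g -` A' \<inter> space X = A'" if g: "g \<in> carrier G" for g
  proof -
    obtain u v where uv: "u \<in> U" "v \<in> V" "g = u \<otimes>\<^bsub>G\<^esub> v" using product[OF g] by blast
    have "a g x \<in> A' \<longleftrightarrow> x \<in> A'" if x: "x \<in> space X" for x
      using invU[OF uv(1) V.action_space[OF uv(2) x]] invV[OF uv(2) x] act_mult[OF U_carrier[OF uv(1)] V_carrier[OF uv(2)] x] uv(3)
      by simp
    then show ?thesis using sets.sets_into_space[OF A'm] by auto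
  qed
  then have "measure X A' = 0 \<or> measure X A' = 1"
    using erg[unfolded ergodic_action_def, rule_format, OF A'm] by simp
  moreover have "AE x in X. x \<in> A' \<longleftrightarrow> x \<in> A"
    using AE_space AB U.AE_action[OF AB]
  proof eventually_elim
    case (elim x)
    \<comment> \<open>Along almost all of the orbit A may be replaced by B, and
      \<open>U\<close>-invariance of B reduces membership to that of x.\<close>
    have 1: "AE u in mU. a (inv\<^bsub>G\<^esub> u) x \<in> A \<longleftrightarrow> x \<in> B"
      using elim(3) AE_space by eventually_elim (use BU U.inv_in elim(1) U.space_haar in auto)
    have 2: "emeasure mU (Z x) = 0 \<longleftrightarrow> (AE u in mU. a (inv\<^bsub>G\<^esub> u) x \<in> A)"
      using AE_iff_measurable[of "Z x" mU "\<lambda>u. a (inv\<^bsub>G\<^esub> u) x \<in> A"] Zs[OF elim(1)] by (auto simp: Z_def U.space_haar)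
    have "x \<in> A' \<longleftrightarrow> x \<in> B"
    proof
      assume "x \<in> B"
      then have "AE u in mU. a (inv\<^bsub>G\<^esub> u) x \<in> A" using 1 by auto
      then show "x \<in> A'" using 2 elim(1) by (simp add: A'_def)
    next
      assume "x \<in> A'"
      then have "AE u in mU. a (inv\<^bsub>G\<^esub> u) x \<in> A" using 2 by (simp add: A'_def)
      with 1 have "AE u in mU. x \<in> B" by eventually_elim simp
      \<comment> \<open>The condition does not involve u, and \<open>mU\<close> is not the zero
        measure.\<close>
      then show "x \<in> B" using U.haar_nonzero U.space_haar
        by (auto simp: eventually_const_iff Measure_Space.ae_filter_eq_bot_iff)
    qed
    then show ?case using elim(2) by simp
  qed
  then have "measure X A' = measure X A"
    using A'm A by (intro measure_eq_AE) auto
  ultimately show ?thesis by simp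
qed

text \<open>A single level suffices. With c the mean of h, the set where the conditional expectation
  k is below c is strictly \<open>U\<close>-invariant and agrees almost everywhere with a strictly
  \<open>V\<close>-invariant set, so the zero-one law applies. Measure 1 would push the mean of k
  below c, although that mean is c. Hence k >= c almost everywhere, and equality of the means gives
  k = c.\<close>

lemma U_inv_exp_constant:
  assumes h: "Lp_fun p X h" and p: "p > 1" and hV: "\<And>v x. v \<in> V \<Longrightarrow> x \<in> space X \<Longrightarrow> h (a v x) = h x"
  shows "AE x in X. U.inv_exp h x = (\<integral>x. h x \<partial>X)"
proof -
  define k where "k = U.inv_exp h"
  have [measurable]: "h \<in> borel_measurable X" using h by (rule Lp_fun_measurable)
  have [measurable]: "k \<in> borel_measurable X" unfolding k_def by measurable
  have hi: "integrable X h" by (rule U.X.Lp_fun_integrable[OF h p])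
  have ki: "integrable X k" "(\<integral>x. k x \<partial>X) = (\<integral>x. h x \<partial>X)" unfolding k_def using U.I.real_cond_exp_int[OF hi] by auto
  define c where "c = (\<integral>x. h x \<partial>X)"
  \<comment> \<open>A limsup in \<open>ereal\<close> exists at every point, so L inherits the
    \<open>V\<close>-invariance of the averages without an exceptional set; running over integers
    keeps it measurable.\<close>
  define L where "L x = limsup (\<lambda>n. ereal (U.A (real (Suc n)) h x))" for x
  have [measurable]: "U.A (real (Suc n)) h \<in> borel_measurable X" for n
    by (rule U.avg_measurable) (use U.E_sets in auto)
  have [measurable]: "L \<in> borel_measurable X" unfolding L_def by measurable
  have Lk: "AE x in X. L x = ereal (k x)"
    using U.pointwise_AE[OF h p]
  proof eventually_elim
    case (elim x)
    have "filterlim (\<lambda>n. real (Suc n)) at_top sequentially"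
      using filterlim_compose[OF filterlim_real_sequentially filterlim_Suc] .
    then have "(\<lambda>n. U.A (real (Suc n)) h x) \<longlonglongrightarrow> k x"
      unfolding k_def by (rule filterlim_compose[OF elim])
    then have "(\<lambda>n. ereal (U.A (real (Suc n)) h x)) \<longlonglongrightarrow> ereal (k x)" by simp
    then show ?case unfolding L_def by (intro lim_imp_Limsup) auto
  qed
  define A where "A = {x \<in> space X. L x < ereal c}"
  have Am: "A \<in> sets X" unfolding A_def by measurable
  have AB: "AE x in X. x \<in> A \<longleftrightarrow> x \<in> {x \<in> space X. k x < c}"
    using Lk AE_space by eventually_elim (auto simp: A_def)
  have "measure X A = 0 \<or> measure X A = 1"
  proof (rule zero_one[OF Am _ _ AB])
    fix v x assume v: "v \<in> V" and x: "x \<in> space X"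
    have "L (a v x) = L x" unfolding L_def using U_average_V_invariant[OF hV v x] by simp
    then show "a v x \<in> A \<longleftrightarrow> x \<in> A" using x V.action_space[OF v x] by (simp add: A_def)
  next
    fix u x assume u: "u \<in> U" and x: "x \<in> space X"
    then show "a u x \<in> {x \<in> space X. k x < c} \<longleftrightarrow> x \<in> {x \<in> space X. k x < c}"
      using U.inv_exp_invariant[OF u x] U.action_space[OF u x] by (simp add: k_def)
  qed
  moreover have "measure X A \<noteq> 1"
  proof
    assume "measure X A = 1"
    then have "AE x in X. x \<in> A" using Am by (simp add: U.X.AE_in_set_eq_1)
    with AB have "AE x in X. k x < c" by eventually_elim auto
    then have "(\<integral>x. k x \<partial>X) < (\<integral>x. c \<partial>X)"
      using ki(1) by (intro U.X.integral_less_AE_space) (auto simp: U.X.emeasure_space_1)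
    then show False using ki(2) by (simp add: c_def U.X.prob_space)
  qed
  ultimately have "A \<in> null_sets X" using Am by (simp add: null_sets_def U.X.emeasure_eq_measure)
  then have "AE x in X. x \<notin> A" by (rule AE_not_in)
  with AB AE_space have ge: "AE x in X. 0 \<le> k x - c" by eventually_elim auto
  have "(\<integral>x. k x - c \<partial>X) = 0" using ki by (simp add: c_def U.X.prob_space)
  then have "AE x in X. k x - c = 0"
    using integral_nonneg_eq_0_iff_AE[OF _ ge] ki(1) by auto
  then show ?thesis unfolding k_def c_def by eventually_elim simp
qed

section \<open>Convergence of the double averages\<close>

lemma double_average_eq:
  assumes x: "x \<in> space X" and T: "T > 0" and S: "S > 0"
  shows "(LINT u:E T|mU. (LINT v:F S|mV. rep G a (u \<otimes>\<^bsub>G\<^esub> v) f x)) / (measure mU (E T) * measure mV (F S))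
    = U.A T (V.A S f) x"
proof -
  have eq: "rep G a (u \<otimes>\<^bsub>G\<^esub> v) f x = rep G a v f (a (inv\<^bsub>G\<^esub> u) x)" if "u \<in> U" "v \<in> V" for u v
    using U_carrier[OF that(1)] V_carrier[OF that(2)] x by (simp add: rep_def U.inv_mult_group act_mult)
  have "(LINT v:F S|mV. rep G a (u \<otimes>\<^bsub>G\<^esub> v) f x) = measure mV (F S) * rep G a u (V.A S f) x" if u: "u \<in> U" for u
  proof -
    have "(LINT v:F S|mV. rep G a (u \<otimes>\<^bsub>G\<^esub> v) f x) = (LINT v:F S|mV. rep G a v f (a (inv\<^bsub>G\<^esub> u) x))"
      using V.E_subset[OF S] V.E_sets[OF S] eq[OF u] by (intro set_lebesgue_integral_cong) auto
    then show ?thesis using V.measure_E_pos[OF S] by (simp add: avg_def rep_def)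
  qed
  then have "(LINT u:E T|mU. (LINT v:F S|mV. rep G a (u \<otimes>\<^bsub>G\<^esub> v) f x))
      = (LINT u:E T|mU. measure mV (F S) * rep G a u (V.A S f) x)"
    using U.E_subset[OF T] U.E_sets[OF T] by (intro set_lebesgue_integral_cong) auto
  then show ?thesis using V.measure_E_pos[OF S] by (simp add: avg_def)
qed

lemma V_average_measurable: "f \<in> borel_measurable X \<Longrightarrow> S > 0 \<Longrightarrow> V.A S f \<in> borel_measurable X"
  by (simp add: V.E_sets V.avg_measurable)

text \<open>The \<open>U\<close>-averages of each majorant converge to its conditional expectation,
  which is small in mean but not necessarily at a given x. The infimum over all majorants vanishes
  almost everywhere, so the majorant can be selected after x and the tolerance.\<close>

lemma product_averages_pointwise:
  assumes f: "Lp_fun p X f" and p: "p > 1"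
  shows "AE x in X. ((\<lambda>(T, S). U.A T (V.A S f) x) \<longlongrightarrow> (\<integral>y. f y \<partial>X)) (at_top \<times>\<^sub>F at_top)"
proof -
  have [measurable]: "f \<in> borel_measurable X" using f by (rule Lp_fun_measurable)
  define h where "h = V.inv_exp f"
  have hLp: "Lp_fun p X h" unfolding h_def by (rule V.inv_exp_Lp[OF f p])
  have [measurable]: "h \<in> borel_measurable X" using hLp by (rule Lp_fun_measurable)
  have hi: "integrable X h" by (rule U.X.Lp_fun_integrable[OF hLp p])
  define c where "c = (\<integral>y. f y \<partial>X)"
  have hc: "(\<integral>y. h y \<partial>X) = c" unfolding h_def c_def
    by (rule V.I.real_cond_exp_int(2)[OF U.X.Lp_fun_integrable[OF f p]])
  have hconst: "AE x in X. U.inv_exp h x = c"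
    using U_inv_exp_constant[OF hLp p] V.inv_exp_invariant hc by (simp add: h_def)
  define Q where "Q k g T0 \<longleftrightarrow> T0 > 0 \<and> Lp_fun p X g \<and> (\<integral>x. g x \<partial>X) \<le> 1 / real (Suc k) \<and>
      (AE x in X. \<forall>S\<ge>T0. \<bar>V.A S f x - h x\<bar> \<le> g x)" for k g T0
  have "\<exists>g T0. Q k g T0" for k
    unfolding h_def Q_def by (rule V.tail_dominated[OF f p]) simp
  then obtain g S0 where "\<And>k. Q k (g k) (S0 k)" by metis
  then have S0: "\<And>k. S0 k > 0" and gLp: "\<And>k. Lp_fun p X (g k)"
    and gI: "\<And>k. (\<integral>x. g k x \<partial>X) \<le> 1 / real (Suc k)"
    and gdom: "\<And>k. AE x in X. \<forall>S\<ge>S0 k. \<bar>V.A S f x - h x\<bar> \<le> g k x"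
    by (simp_all add: Q_def)
  have [measurable]: "g k \<in> borel_measurable X" for k using gLp by (rule Lp_fun_measurable)
  have gi: "integrable X (g k)" for k by (rule U.X.Lp_fun_integrable[OF gLp p])
  have g0: "AE x in X. 0 \<le> g k x" for k
    using gdom[of k] by eventually_elim (meson abs_ge_zero order.refl order_trans)
  have G0: "AE x in X. 0 \<le> U.inv_exp (g k) x" for k
    by (rule U.I.real_cond_exp_pos[OF g0]) measurable
  have "AE x in X. (INF k. ennreal (U.inv_exp (g k) x)) = 0"
  proof -
    \<comment> \<open>The infimum lies below every term, so its integral is at most 1 / (k + 1) for
      every k and therefore 0.\<close>
    have "(\<integral>\<^sup>+x. (INF k. ennreal (U.inv_exp (g k) x)) \<partial>X) \<le> ennreal (1 / real (Suc k))" for k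
    proof -
      have "(\<integral>\<^sup>+x. (INF k. ennreal (U.inv_exp (g k) x)) \<partial>X) \<le> (\<integral>\<^sup>+x. ennreal (U.inv_exp (g k) x) \<partial>X)"
        by (intro nn_integral_mono INF_lower) auto
      also have "\<dots> = ennreal (\<integral>x. U.inv_exp (g k) x \<partial>X)"
        by (intro nn_integral_eq_integral G0 U.I.real_cond_exp_int gi)
      also have "\<dots> \<le> ennreal (1 / real (Suc k))"
        using gI[of k] U.I.real_cond_exp_int(2)[OF gi[of k]] by (intro ennreal_leI) simp
      finally show ?thesis .
    qed
    moreover have "(\<lambda>k. ennreal (1 / real (Suc k))) \<longlonglongrightarrow> ennreal 0"
      using LIMSEQ_inverse_real_of_nat by (intro tendsto_ennrealI) (simp add: inverse_eq_divide)
    ultimately have "(\<integral>\<^sup>+x. (INF k. ennreal (U.inv_exp (g k) x)) \<partial>X) \<le> ennreal 0"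
      by (intro LIMSEQ_le_const) blast+
    then have "(\<integral>\<^sup>+x. (INF k. ennreal (U.inv_exp (g k) x)) \<partial>X) = 0" by simp
    then show ?thesis by (subst (asm) nn_integral_0_iff_AE) measurable
  qed
  moreover have "AE x in X. \<forall>k. ((\<lambda>T. U.A T (g k) x) \<longlongrightarrow> U.inv_exp (g k) x) at_top"
    using U.pointwise_AE[OF gLp p] by (simp add: AE_all_countable)
  moreover have "AE x in X. \<forall>k. \<forall>K. compactin (subtopology \<tau> U) K \<longrightarrow> set_integrable mU K (\<lambda>u. rep G a u (g k) x)"
    using U.AE_set_integrable_rep[OF gi] by (simp add: AE_all_countable)
  \<comment> \<open>The domination is transported to the orbit of x. For each k the exceptional set
    of u serves all S >= \<open>S0 k\<close> at once, so it depends neither on S nor on T.\<close>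
  moreover have "AE x in X. \<forall>k. AE u in mU. \<forall>S\<ge>S0 k. \<bar>V.A S f (a (inv\<^bsub>G\<^esub> u) x) - h (a (inv\<^bsub>G\<^esub> u) x)\<bar> \<le> g k (a (inv\<^bsub>G\<^esub> u) x)"
    using U.AE_action[OF gdom] by (simp add: AE_all_countable)
  ultimately show ?thesis
    using U.pointwise_AE[OF hLp p] hconst U.AE_set_integrable_rep[OF hi] AE_space
  proof eventually_elim
    case (elim x)
    note inf0 = elim(1) and glim = elim(2) and gint = elim(3) and dom = elim(4)
      and hlim = elim(5,6) and hint = elim(7) and x = elim(8)
    have bound: "\<bar>U.A T (V.A S f) x - c\<bar> \<le> U.A T (g k) x + \<bar>U.A T h x - c\<bar>" if T: "T > 0" and S: "S \<ge> S0 k" for T S k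
    proof -
      have S': "S > 0" using S S0[of k] by linarith
      note ET = U.E_sets[OF T]
      have gk: "set_integrable mU (E T) (\<lambda>u. rep G a u (g k) x)" using gint U.compact_E[OF T] by blast
      have hk: "set_integrable mU (E T) (\<lambda>u. rep G a u h x)" using hint U.compact_E[OF T] by blast
      have d: "AE u in mU. \<bar>rep G a u (\<lambda>y. V.A S f y - h y) x\<bar> \<le> rep G a u (g k) x"
        using dom[rule_format, of k] by eventually_elim (use S in \<open>simp add: rep_def\<close>)
      have [measurable]: "V.A S f \<in> borel_measurable X" by (rule V_average_measurable) (use S' in auto)
      \<comment> \<open>Integrability of the remainder along the orbit is derived from the majorant:
        quoting an almost-everywhere result for \<open>V.A S f\<close> would leave one null set for
        each of uncountably many S.\<close>
      have dk: "set_integrable mU (E T) (\<lambda>u. rep G a u (\<lambda>y. V.A S f y - h y) x)"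
      proof (rule set_integrable_bound[OF gk])
        show "set_borel_measurable mU (E T) (\<lambda>u. rep G a u (\<lambda>y. V.A S f y - h y) x)"
          unfolding set_borel_measurable_def
          using U.rep_measurable_group[of "\<lambda>y. V.A S f y - h y" x] x ET by measurable
        show "AE u in mU. u \<in> E T \<longrightarrow> norm (rep G a u (\<lambda>y. V.A S f y - h y) x) \<le> norm (rep G a u (g k) x)"
          using d by eventually_elim auto
      qed
      have "set_integrable mU (E T) (\<lambda>u. rep G a u (V.A S f) x)"
        using set_integral_add(1)[OF dk hk] by (simp add: rep_def)
      then have "U.A T (\<lambda>y. V.A S f y - h y) x = U.A T (V.A S f) x - U.A T h x"
        using hk by (rule U.avg_diff)
      moreover have "\<bar>U.A T (\<lambda>y. V.A S f y - h y) x\<bar> \<le> U.A T (g k) x"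
        using d by (intro U.avg_le gk ET) auto
      ultimately show ?thesis by linarith
    qed
    show ?case unfolding c_def[symmetric]
    proof (rule tendstoI)
      fix e :: real assume e: "e > 0"
      have "(INF k. ennreal (U.inv_exp (g k) x)) < ennreal (e / 3)" using inf0 e by simp
      then obtain k where "ennreal (U.inv_exp (g k) x) < ennreal (e / 3)" by (auto simp: INF_less_iff)
      then have k: "U.inv_exp (g k) x < e / 3" using ennreal_leI[of "e / 3" "U.inv_exp (g k) x"] by fastforce
      have "\<forall>\<^sub>F T in at_top. U.A T (g k) x < e / 3" using glim k by (intro order_tendstoD) auto
      moreover have "\<forall>\<^sub>F T in at_top. dist (U.A T h x) c < e / 3" using hlim e by (intro tendstoD) auto
      moreover have "\<forall>\<^sub>F T::real in at_top. T > 0" by (rule eventually_gt_at_top)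
      ultimately have "\<forall>\<^sub>F T in at_top. U.A T (g k) x < e / 3 \<and> \<bar>U.A T h x - c\<bar> < e / 3 \<and> T > 0"
        by eventually_elim (auto simp: dist_real_def)
      moreover have "\<forall>\<^sub>F S in at_top. S \<ge> S0 k" by (rule eventually_ge_at_top)
      \<comment> \<open>With k fixed, the conditions on T and on S are independent of each other;
        this gives the joint limit and not only an iterated one.\<close>
      ultimately have "\<forall>\<^sub>F (T, S) in at_top \<times>\<^sub>F at_top. (U.A T (g k) x < e / 3 \<and> \<bar>U.A T h x - c\<bar> < e / 3 \<and> T > 0) \<and> S \<ge> S0 k"
        unfolding eventually_prod_filter by blast
      then show "\<forall>\<^sub>F z in at_top \<times>\<^sub>F at_top. dist (case z of (T, S) \<Rightarrow> U.A T (V.A S f) x) c < e"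
      proof (rule eventually_mono)
        fix z assume *: "case z of (T, S) \<Rightarrow> (U.A T (g k) x < e / 3 \<and> \<bar>U.A T h x - c\<bar> < e / 3 \<and> T > 0) \<and> S \<ge> S0 k"
        obtain T S where z: "z = (T, S)" by (cases z)
        have "\<bar>U.A T (V.A S f) x - c\<bar> < e" using * z bound[of T k S] e by auto
        then show "dist (case z of (T, S) \<Rightarrow> U.A T (V.A S f) x) c < e" using z by (simp add: dist_real_def)
      qed
    qed
  qed
qed

text \<open>With h the limit of the \<open>V\<close>-averages, \<open>U\<close>-averaging multiplies
  the norm of the remainder \<open>V.A S f\<close> - h by a factor bounded independently of T, so it
  is small for large S alone. What remains is norm convergence of the \<open>U\<close>-averages of
  h, which involves T alone.\<close>

lemma product_averages_Lp:
  assumes f: "Lp_fun p X f" and p: "p > 1"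
  shows "((\<lambda>(T, S). \<integral>\<^sup>+ x. ennreal (\<bar>U.A T (V.A S f) x - (\<integral>y. f y \<partial>X)\<bar> powr p) \<partial>X) \<longlongrightarrow> 0) (at_top \<times>\<^sub>F at_top)"
proof -
  define h where "h = V.inv_exp f"
  have hLp: "Lp_fun p X h" unfolding h_def by (rule V.inv_exp_Lp[OF f p])
  have [measurable]: "h \<in> borel_measurable X" using hLp by (rule Lp_fun_measurable)
  have hi: "integrable X h" by (rule U.X.Lp_fun_integrable[OF hLp p])
  define c where "c = (\<integral>y. f y \<partial>X)"
  have hc: "(\<integral>y. h y \<partial>X) = c" unfolding h_def c_def
    by (rule V.I.real_cond_exp_int(2)[OF U.X.Lp_fun_integrable[OF f p]])
  have hconst: "AE x in X. U.inv_exp h x = c"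
    using U_inv_exp_constant[OF hLp p] V.inv_exp_invariant hc by (simp add: h_def)
  obtain C :: real where C: "C \<ge> 0" "\<And>f T. Lp_fun p X f \<Longrightarrow> T > 0 \<Longrightarrow> (\<integral>\<^sup>+ y. ennreal (\<bar>U.A T f y\<bar> powr p) \<partial>X)
        \<le> ennreal C * (\<integral>\<^sup>+ y. ennreal (\<bar>f y\<bar> powr p) \<partial>X)"
    by (rule U.maximal_constant[OF p]) metis
  define \<alpha> where "\<alpha> S = (\<integral>\<^sup>+ x. ennreal (\<bar>V.A S f x - h x\<bar> powr p) \<partial>X)" for S
  define \<beta> where "\<beta> T = (\<integral>\<^sup>+ x. ennreal (\<bar>U.A T h x - c\<bar> powr p) \<partial>X)" for T
  have \<alpha>: "(\<alpha> \<longlongrightarrow> 0) at_top" unfolding \<alpha>_def h_def by (rule V.pointwise_Lp[OF f p])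
  have "(\<integral>\<^sup>+ x. ennreal (\<bar>U.A T h x - U.inv_exp h x\<bar> powr p) \<partial>X) = \<beta> T" for T
    unfolding \<beta>_def by (rule nn_integral_cong_AE) (use hconst in eventually_elim, simp)
  then have \<beta>: "(\<beta> \<longlongrightarrow> 0) at_top" using U.pointwise_Lp[OF hLp p] by simp
  have le: "(\<integral>\<^sup>+ x. ennreal (\<bar>U.A T (V.A S f) x - c\<bar> powr p) \<partial>X) \<le> ennreal (2 powr p) * (ennreal C * \<alpha> S + \<beta> T)"
    if T: "T > 0" and S: "S > 0" for T S
  proof -
    have AfLp: "Lp_fun p X (V.A S f)" by (rule V.avg_Lp[OF f p S])
    have dLp: "Lp_fun p X (\<lambda>x. V.A S f x - h x)" using Lp_fun_diff[OF AfLp hLp] p by simp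
    have [measurable]: "U.A T (\<lambda>x. V.A S f x - h x) \<in> borel_measurable X" "U.A T h \<in> borel_measurable X"
      using U.avg_Lp[OF dLp p T] U.avg_Lp[OF hLp p T] by (auto intro: Lp_fun_measurable)
    have "AE x in X. U.A T (V.A S f) x - c = U.A T (\<lambda>x. V.A S f x - h x) x + (U.A T h x - c)"
      using U.AE_set_integrable_rep[OF U.X.Lp_fun_integrable[OF AfLp p]] U.AE_set_integrable_rep[OF hi]
    proof eventually_elim
      case (elim x)
      then show ?case using U.avg_diff[of T "V.A S f" x h] U.compact_E[OF T] by simp
    qed
    then have "(\<integral>\<^sup>+ x. ennreal (\<bar>U.A T (V.A S f) x - c\<bar> powr p) \<partial>X)
        = (\<integral>\<^sup>+ x. ennreal (\<bar>U.A T (\<lambda>x. V.A S f x - h x) x + (U.A T h x - c)\<bar> powr p) \<partial>X)"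
      by (intro nn_integral_cong_AE) (elim eventually_mono, simp only:)
    also have "\<dots> \<le> ennreal (2 powr p) * ((\<integral>\<^sup>+ x. ennreal (\<bar>U.A T (\<lambda>x. V.A S f x - h x) x\<bar> powr p) \<partial>X) + \<beta> T)"
      unfolding \<beta>_def using p by (intro nn_integral_powr_add_le) auto
    also have "\<dots> \<le> ennreal (2 powr p) * (ennreal C * \<alpha> S + \<beta> T)"
      unfolding \<alpha>_def by (intro mult_left_mono add_right_mono C(2)[OF dLp T]) auto
    finally show ?thesis .
  qed
  have "((\<lambda>z. ennreal (2 powr p) * (ennreal C * \<alpha> (snd z) + \<beta> (fst z))) \<longlongrightarrow> ennreal (2 powr p) * (ennreal C * 0 + 0)) (at_top \<times>\<^sub>F at_top)"
    by (intro tendsto_add ennreal_tendsto_cmult filterlim_compose[OF \<alpha> filterlim_snd] filterlim_compose[OF \<beta> filterlim_fst]) auto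
  then have lim: "((\<lambda>z. ennreal (2 powr p) * (ennreal C * \<alpha> (snd z) + \<beta> (fst z))) \<longlongrightarrow> 0) (at_top \<times>\<^sub>F at_top)" by simp
  have "\<forall>\<^sub>F (T, S) in at_top \<times>\<^sub>F at_top. (T::real) > 0 \<and> (S::real) > 0"
    unfolding eventually_prod_filter using eventually_gt_at_top[of "0::real"] by blast
  then have "\<forall>\<^sub>F z in at_top \<times>\<^sub>F at_top. (case z of (T, S) \<Rightarrow> \<integral>\<^sup>+ x. ennreal (\<bar>U.A T (V.A S f) x - c\<bar> powr p) \<partial>X)
      \<le> ennreal (2 powr p) * (ennreal C * \<alpha> (snd z) + \<beta> (fst z))"
    by (rule eventually_mono) (auto intro: le)
  then show ?thesis unfolding c_def[symmetric]
    by (intro tendsto_sandwich[OF _ _ tendsto_const lim]) auto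
qed

text \<open>Change of variables followed by Fubini. Fubini for Bochner integrals needs integrability
  on the rectangle, which is available for almost every x because the image of the rectangle is
  compact; hence the exceptional null set.\<close>

lemma product_averages_eq_avg:
  assumes psi: "homeomorphic_map (prod_topology (subtopology \<tau> U) (subtopology \<tau> V)) \<tau> (\<lambda>(u, v). u \<otimes>\<^bsub>G\<^esub> v)"
    and f: "integrable X f" and T: "T > 0" and S: "S > 0"
  shows "AE x in X. (LINT u:E T|mU. (LINT v:F S|mV. rep G a (u \<otimes>\<^bsub>G\<^esub> v) f x)) / (measure mU (E T) * measure mV (F S))
    = avg G (distr (mU \<Otimes>\<^sub>M mV) (borel_of \<tau>) (\<lambda>(u, v). u \<otimes>\<^bsub>G\<^esub> v)) ((\<lambda>(u, v). u \<otimes>\<^bsub>G\<^esub> v) ` (E T \<times> F S)) a f x"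
proof -
  define \<psi> where "\<psi> = (\<lambda>(u, v). u \<otimes>\<^bsub>G\<^esub> v)"
  define M where "M = mU \<Otimes>\<^sub>M mV"
  define \<nu> where "\<nu> = distr M (borel_of \<tau>) \<psi>"
  define Q where "Q = \<psi> ` (E T \<times> F S)"
  have top: "topspace \<tau> = carrier G" using U.lcsc by (simp add: lcsc_group_def)
  then have subt: "subtopology \<tau> (carrier G) = \<tau>" by (metis subtopology_topspace)
  interpret UV: pair_sigma_finite mU mV ..
  have \<psi>m: "\<psi> \<in> measurable M (borel_of \<tau>)" and haar: "left_haar G \<tau> (carrier G) \<nu>"
    using product_left_haar[OF U.lcsc U.subgroup U.closed V.subgroup V.closed normal psi U.haar V.haar]
    by (simp_all add: M_def \<psi>_def \<nu>_def)
  \<comment> \<open>\<open>G\<close> is a closed subgroup of itself and the image measure is its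
    Haar measure, so orbit integrability over compact sets applies to \<open>Q\<close>.\<close>
  interpret W: haar_action G \<tau> "carrier G" \<nu> X a
    using U.lcsc haar act top closedin_topspace[of \<tau>] by (intro haar_action.intro U.subgroup_self) auto
  have sub: "E T \<times> F S \<subseteq> U \<times> V" using U.E_subset[OF T] V.E_subset[OF S] by auto
  have topUV: "topspace (subtopology \<tau> U) = U" "topspace (subtopology \<tau> V) = V"
    using U.space_eq V.space_eq U.space_haar V.space_haar by auto
  have "compactin (prod_topology (subtopology \<tau> U) (subtopology \<tau> V)) (E T \<times> F S)"
    using U.compact_E[OF T] V.compact_E[OF S] by (simp add: compactin_Times)
  then have Qc: "compactin (subtopology \<tau> (carrier G)) Q"
    unfolding Q_def subt using homeomorphic_imp_continuous_map[OF psi] by (auto simp: \<psi>_def intro: image_compactin)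
  have Qs: "Q \<in> sets \<nu>" "Q \<in> sets (borel_of \<tau>)" using W.compact_sets[OF Qc] by (auto simp: \<nu>_def)
  have inj: "inj_on \<psi> (U \<times> V)"
    using homeomorphic_imp_injective_map[OF psi] topUV by (simp add: \<psi>_def)
  have spM: "space M = U \<times> V" by (simp add: M_def space_pair_measure U.space_haar V.space_haar)
  \<comment> \<open>Injectivity of the multiplication map keeps the preimage of \<open>Q\<close>
    from exceeding the rectangle.\<close>
  have Qpre: "\<psi> z \<in> Q \<longleftrightarrow> z \<in> E T \<times> F S" if "z \<in> space M" for z
    using inj_on_image_mem_iff[OF inj _ sub, of z] that by (simp add: Q_def spM)
  have "emeasure \<nu> Q = emeasure M (E T \<times> F S)"
  proof -
    have "\<psi> -` Q \<inter> space M = E T \<times> F S" using Qpre sub spM by auto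
    then show ?thesis unfolding \<nu>_def using emeasure_distr[OF \<psi>m Qs(2)] by simp
  qed
  also have "\<dots> = emeasure mU (E T) * emeasure mV (F S)"
    unfolding M_def by (rule V.\<mu>.emeasure_pair_measure_Times[OF U.E_sets[OF T] V.E_sets[OF S]])
  finally have mQ: "measure \<nu> Q = measure mU (E T) * measure mV (F S)"
    by (simp add: measure_def enn2real_mult)
  have "AE x in X. (LINT u:E T|mU. (LINT v:F S|mV. rep G a (u \<otimes>\<^bsub>G\<^esub> v) f x)) = (LINT g:Q|\<nu>. rep G a g f x)"
    using W.AE_set_integrable_rep[OF f] AE_space
  proof eventually_elim
    case (elim x)
    let ?k = "\<lambda>z. indicat_real (E T \<times> F S) z *\<^sub>R rep G a (\<psi> z) f x"
    have int: "integrable \<nu> (\<lambda>g. indicat_real Q g *\<^sub>R rep G a g f x)"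
      using elim(1) Qc by (simp add: set_integrable_def)
    then have meas: "(\<lambda>g. indicat_real Q g *\<^sub>R rep G a g f x) \<in> borel_measurable (borel_of \<tau>)"
      by (auto simp: \<nu>_def dest: borel_measurable_integrable)
    have k: "indicat_real Q (\<psi> z) *\<^sub>R rep G a (\<psi> z) f x = ?k z" if "z \<in> space M" for z
      using Qpre[OF that] by (simp add: indicator_def)
    have "integrable M (\<lambda>z. indicat_real Q (\<psi> z) *\<^sub>R rep G a (\<psi> z) f x)"
      using int unfolding \<nu>_def by (rule integrable_distr_eq[OF \<psi>m meas, THEN iffD1])
    moreover have "integrable M (\<lambda>z. indicat_real Q (\<psi> z) *\<^sub>R rep G a (\<psi> z) f x) \<longleftrightarrow> integrable M ?k"
      by (rule Bochner_Integration.integrable_cong[OF refl]) (rule k)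
    ultimately have ki: "integrable M ?k" by simp
    have "(LINT g:Q|\<nu>. rep G a g f x) = (\<integral>z. indicat_real Q (\<psi> z) *\<^sub>R rep G a (\<psi> z) f x \<partial>M)"
      unfolding set_lebesgue_integral_def \<nu>_def by (rule integral_distr[OF \<psi>m meas])
    also have "\<dots> = (\<integral>z. ?k z \<partial>M)" using k by (intro Bochner_Integration.integral_cong) auto
    also have "\<dots> = (\<integral>u. (\<integral>v. ?k (u, v) \<partial>mV) \<partial>mU)"
      using UV.integral_fst'[of ?k] ki unfolding M_def by simp
    also have "\<dots> = (LINT u:E T|mU. (LINT v:F S|mV. rep G a (u \<otimes>\<^bsub>G\<^esub> v) f x))"
      unfolding set_lebesgue_integral_def
    proof (intro Bochner_Integration.integral_cong refl)
      fix u
      have "(\<integral>v. ?k (u, v) \<partial>mV) = (\<integral>v. indicat_real (E T) u *\<^sub>R (indicat_real (F S) v *\<^sub>R rep G a (u \<otimes>\<^bsub>G\<^esub> v) f x) \<partial>mV)"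
        by (intro Bochner_Integration.integral_cong refl) (simp add: \<psi>_def indicator_times)
      also have "\<dots> = indicat_real (E T) u *\<^sub>R (\<integral>v. indicat_real (F S) v *\<^sub>R rep G a (u \<otimes>\<^bsub>G\<^esub> v) f x \<partial>mV)"
        by (rule integral_scaleR_right)
      finally show "(\<integral>v. ?k (u, v) \<partial>mV) = indicat_real (E T) u *\<^sub>R (\<integral>v. indicat_real (F S) v *\<^sub>R rep G a (u \<otimes>\<^bsub>G\<^esub> v) f x \<partial>mV)" .
    qed
    finally show ?case by simp
  qed
  then show ?thesis
    by eventually_elim (simp add: avg_def mQ[unfolded \<nu>_def M_def Q_def \<psi>_def] \<nu>_def M_def Q_def \<psi>_def)
qed

end

text \<open>Only joint measurability needs an argument: the inclusion of the subgroup is continuous,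
  hence Borel.\<close>

lemma mp_action_subgroup:
  assumes G: "lcsc_group G \<tau>" and act: "mp_action G \<tau> (carrier G) X a" and H: "subgroup H G"
  shows "mp_action G \<tau> H X a"
proof -
  have c: "h \<in> carrier G" if "h \<in> H" for h using that subgroup.mem_carrier[OF H] by simp
  have "continuous_map (subtopology \<tau> H) (subtopology \<tau> (carrier G)) (\<lambda>x. x)"
    using G c by (intro continuous_map_into_subtopology continuous_map_from_subtopology) (auto simp: lcsc_group_def)
  then have "(\<lambda>x. x) \<in> measurable (borel_of (subtopology \<tau> H)) (borel_of (subtopology \<tau> (carrier G)))"
    by (rule continuous_map_measurable_borel_of)
  then have "(\<lambda>z. (fst z, snd z)) \<in> measurable (borel_of (subtopology \<tau> H) \<Otimes>\<^sub>M X) (borel_of (subtopology \<tau> (carrier G)) \<Otimes>\<^sub>M X)"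
    by (intro measurable_Pair measurable_snd measurable_compose[OF measurable_fst])
  moreover have "(\<lambda>(g, y). a g y) \<in> measurable (borel_of (subtopology \<tau> (carrier G)) \<Otimes>\<^sub>M X) X"
    using act by (simp add: mp_action_def)
  ultimately have "(\<lambda>(g, y). a g y) \<circ> (\<lambda>z. (fst z, snd z)) \<in> measurable (borel_of (subtopology \<tau> H) \<Otimes>\<^sub>M X) X"
    by (rule measurable_comp)
  then have "(\<lambda>(g, y). a g y) \<in> measurable (borel_of (subtopology \<tau> H) \<Otimes>\<^sub>M X) X" by (simp add: comp_def)
  then show ?thesis using act c by (simp add: mp_action_def)
qed

theorem theorem7p8:
  fixes G :: "('g, 'b) monoid_scheme" and \<tau> :: "'g topology"
    and U V :: "'g set" and mU mV :: "'g measure"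
    and E F :: "real \<Rightarrow> 'g set"
    and X :: "'x measure" and a :: "'g \<Rightarrow> 'x \<Rightarrow> 'x"
  assumes G: "lcsc_group G \<tau>"
    and U: "subgroup U G" "closedin \<tau> U"
    and V: "subgroup V G" "closedin \<tau> V" "normal V G" "amenable G \<tau> V"
    and psi: "homeomorphic_map (prod_topology (subtopology \<tau> U) (subtopology \<tau> V)) \<tau>
                (\<lambda>(u, v). u \<otimes>\<^bsub>G\<^esub> v)"
    and mU: "left_haar G \<tau> U mU" and mV: "left_haar G \<tau> V mV"
    and E: "\<And>T. T > 0 \<Longrightarrow> compactin (subtopology \<tau> U) (E T) \<and>
               0 < emeasure mU (E T) \<and> emeasure mU (E T) < \<infinity>"
    and F: "\<And>S. S > 0 \<Longrightarrow> compactin (subtopology \<tau> V) (F S) \<and>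
               0 < emeasure mV (F S) \<and> emeasure mV (F S) < \<infinity>"
    and Foelner: "\<And>v. v \<in> V \<Longrightarrow>
       ((\<lambda>S. measure mV (((\<lambda>w. w \<otimes>\<^bsub>G\<^esub> v) ` F S - F S) \<union> (F S - (\<lambda>w. w \<otimes>\<^bsub>G\<^esub> v) ` F S))
              / measure mV (F S)) \<longlongrightarrow> 0) at_top"
    and E_ergodic: "\<And>(Y :: 'x measure) b p. mp_action G \<tau> U Y b \<Longrightarrow> 1 < p \<Longrightarrow>
       strong_maximal_ineq G mU E p Y b \<and> pointwise_ergodic_thm G U mU E p Y b"
    and F_ergodic: "\<And>(Y :: 'x measure) b p. mp_action G \<tau> V Y b \<Longrightarrow> 1 < p \<Longrightarrow>
       strong_maximal_ineq G mV F p Y b \<and> pointwise_ergodic_thm G V mV F p Y b"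
    and act: "mp_action G \<tau> (carrier G) X a"
    and erg: "ergodic_action G (carrier G) X a"
    and p: "1 < p" and f: "Lp_fun p X f"
  shows
   "(AE x in X. ((\<lambda>(T, S). (LINT u:E T|mU. (LINT v:F S|mV. rep G a (u \<otimes>\<^bsub>G\<^esub> v) f x))
                    / (measure mU (E T) * measure mV (F S)))
                 \<longlongrightarrow> (\<integral>y. f y \<partial>X)) (at_top \<times>\<^sub>F at_top))
    \<and> ((\<lambda>(T, S). \<integral>\<^sup>+ x. ennreal (\<bar>(LINT u:E T|mU. (LINT v:F S|mV. rep G a (u \<otimes>\<^bsub>G\<^esub> v) f x))
                    / (measure mU (E T) * measure mV (F S)) - (\<integral>y. f y \<partial>X)\<bar> powr p) \<partial>X)
        \<longlongrightarrow> 0) (at_top \<times>\<^sub>F at_top)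
    \<and> left_haar G \<tau> (carrier G) (distr (mU \<Otimes>\<^sub>M mV) (borel_of \<tau>) (\<lambda>(u, v). u \<otimes>\<^bsub>G\<^esub> v))
    \<and> (\<forall>T>0. \<forall>S>0. AE x in X.
         (LINT u:E T|mU. (LINT v:F S|mV. rep G a (u \<otimes>\<^bsub>G\<^esub> v) f x))
           / (measure mU (E T) * measure mV (F S))
         = avg G (distr (mU \<Otimes>\<^sub>M mV) (borel_of \<tau>) (\<lambda>(u, v). u \<otimes>\<^bsub>G\<^esub> v))
               ((\<lambda>(u, v). u \<otimes>\<^bsub>G\<^esub> v) ` (E T \<times> F S)) a f x)"
proof -
  note actU = mp_action_subgroup[OF G act U(1)] and actV = mp_action_subgroup[OF G act V(1)]
  have product: "\<exists>u\<in>U. \<exists>v\<in>V. g = u \<otimes>\<^bsub>G\<^esub> v" if "g \<in> carrier G" for g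
  proof -
    have "g \<in> (\<lambda>(u, v). u \<otimes>\<^bsub>G\<^esub> v) ` (topspace (prod_topology (subtopology \<tau> U) (subtopology \<tau> V)))"
      using homeomorphic_imp_surjective_map[OF psi] that G by (simp add: lcsc_group_def)
    then show ?thesis by auto
  qed
  interpret product_averages G \<tau> U mU X a E V mV F
    by (intro product_averages.intro ergodic_averages.intro haar_action.intro
        ergodic_averages_axioms.intro product_averages_axioms.intro)
      (use G U V mU mV E F E_ergodic[OF actU] F_ergodic[OF actV] actU actV act erg product in \<open>blast+\<close>)
  \<comment> \<open>The quotient of integrals is identified with the iterated average only for
    positive parameters, which is enough for limits along this filter.\<close>
  have ev: "\<forall>\<^sub>F z in at_top \<times>\<^sub>F at_top. fst z > (0::real) \<and> snd z > (0::real)"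
    unfolding eventually_prod_filter
    by (intro exI[of _ "\<lambda>x. x > 0"] conjI eventually_gt_at_top) auto
  have "AE x in X. ((\<lambda>(T, S). (LINT u:E T|mU. (LINT v:F S|mV. rep G a (u \<otimes>\<^bsub>G\<^esub> v) f x))
                    / (measure mU (E T) * measure mV (F S)))
                 \<longlongrightarrow> (\<integral>y. f y \<partial>X)) (at_top \<times>\<^sub>F at_top)"
    using product_averages_pointwise[OF f p] AE_space
  proof eventually_elim
    case (elim x)
    show ?case
      by (rule Lim_transform_eventually[OF elim(1)], rule eventually_mono[OF ev])
        (use double_average_eq[OF elim(2)] in \<open>auto simp: case_prod_beta\<close>)
  qed
  moreover have "((\<lambda>(T, S). \<integral>\<^sup>+ x. ennreal (\<bar>(LINT u:E T|mU. (LINT v:F S|mV. rep G a (u \<otimes>\<^bsub>G\<^esub> v) f x))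
                    / (measure mU (E T) * measure mV (F S)) - (\<integral>y. f y \<partial>X)\<bar> powr p) \<partial>X)
        \<longlongrightarrow> 0) (at_top \<times>\<^sub>F at_top)"
    by (rule Lim_transform_eventually[OF product_averages_Lp[OF f p]], rule eventually_mono[OF ev])
      (auto simp: case_prod_beta double_average_eq intro!: nn_integral_cong)
  ultimately show ?thesis
    by (intro conjI allI impI product_left_haar(2)[OF G U V(1-3) psi mU mV]
      product_averages_eq_avg[OF psi U.X.Lp_fun_integrable[OF f p]])
qed

end
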